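(* Let $\mathrm I=\{\text{S-Step},\text{S-AbsX},\text{S-AbsP},\text{I-Event},\text{I-Border}\}\cup \mathrm F$ with $\mathrm F=\{\text{F-Fail},\text{F-Recover}\}$ be the rules of the stateful dataflow implementation model, let $K$ be its set of valid initial configurations, and let $\mathrm{out}$ be its output-messages function. Then $\mathrm I$ is failure transparent with respect to the failure rules $\mathrm F$ for the observability function $\mathrm{out}$ and the set of initial configurations $K$. That is, for every $c\in K$ and every execution $C\in\mathbb E_c^{\mathrm I}$ (of finite or infinite length $n$) there exists a failure-free execution $C'\in\mathbb E_c^{\mathrm I\setminus \mathrm F}$ (of finite or infinite length $n'$) such that $$\forall m<n.\ \exists m'<n'.\quad \mathrm{out}(C_m)=\mathrm{out}(C'_{m'}).$$
   Context: **Notation.** A sequence $S$ is a function on $\{i\in\mathbb N: i<|S|\}$, $|S|$ possibly infinite; $S:S'$ is concatenation, $[x]$ a one-element sequence, $\varepsilon$ the empty one. For partial functions, $f[k\mapsto x]$ is $f$ updated at $k$ to have value $x$. **Configurations.** A configuration is a tuple $c=\langle \Pi,\Sigma,N,M,M_0\rangle$. $\Pi$ is a finite nonempty sequence of processors (tasks) $\Pi_p=\mathrm{TK}\langle f,S,o\rangle$, where $S$ is a finite sequence of input stream names, $o$ is the output stream name, and $f$ is a function mapping a state value $v$ and an input value $w$ to a pair $f(v,w)=(v',W')$ of a new state value and a sequence $W'$ of output values. $\Sigma$ assigns to each processor $p$ a state $\Sigma_p=\langle a,\sigma_V\rangle$, where the snapshot archive $a$ is a finite partial map from epoch numbers $e\in\mathbb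 N$ to values, and the volatile state $\sigma_V$ is either $\mathtt{fl}$ (failed) or $\langle e,v\rangle$ (normal: current epoch number and value). $N$ assigns to each processor $p$ a map $N_p$ from stream names (those which $p$ reads or writes) to sequence numbers in $\mathbb N$. $M$ and $M_0$ are sets of messages $n\,s\,\langle e,d\rangle$, with $n\in\mathbb N$ a sequence number, $s$ a stream name, $e$ an epoch number and $d$ either an event $\mathtt{EV}\langle w\rangle$ or an epoch border $\mathtt{BD}$. **Actions.** An action is a production $+\,s\,\delta$ or a consumption $-\,s\,\delta$ with $\delta=\langle e,d\rangle$. Application: $(+\,s\,\delta)(N_p,M)=(N_p[s\mapsto N_p(s)+1],\,M\cup\{N_p(s)\,s\,\delta\})$; $(-\,s\,\delta)(N_p,M)=(N_p[s\mapsto N_p(s)+1],\,M)$ if $N_p(s)\,s\,\delta\in M$, and undefined otherwise; for finite action sequences, $([x]:X)(N_p,M)=X(x(N_p,M))$ and $\varepsilon(N_p,M)=(N_p,M)$. **Local rules** (derive $\pi\Vdash\sigma\xrightarrow{X}\sigma'$ for a task $\pi=\mathrm{TK}\langle f,S,o\rangle$). - I-Event: if $f(v,w)=(v',W')$ with $|W'|=k$ finite, and $j<|S|$, then $\pi\Vdash\langle a,\langle e,v\rangle\rangle\xrightarrow{X}\langle a,\langle e,v'\rangle\rangle$ with $X=[-\,S_j\,\langle e,\mathtt{EV}\langle w\rangle\rangle]:[+\,o\,\langle e,\mathtt{EV}\langle W'_i\rangle\rangle]_{i<k}$. - I-Border: $\pi\Vdash\langle a,\langle e,v\rangle\rangle\xrightarrow{X}\langle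 a[e\mapsto v],\langle e+1,v\rangle\rangle$ with $X=[-\,S_i\,\langle e,\mathtt{BD}\rangle]_{i<|S|}:[+\,o\,\langle e,\mathtt{BD}\rangle]$. - F-Fail: $\pi\Vdash\langle a,\sigma_V\rangle\xrightarrow{\varepsilon}\langle a,\mathtt{fl}\rangle$. **Global rules.** - S-Step: if $\Pi_p\Vdash\Sigma_p\xrightarrow{X}\Sigma'_p$ and $X(N_p,M)=(N'_p,M')$ then $\langle\Pi,\Sigma,N,M,M_0\rangle\Rightarrow\langle\Pi,\Sigma[p\mapsto\Sigma'_p],N[p\mapsto N'_p],M',M_0\rangle$, the arrow being labelled by $p$, $N_p$, $X$. The rules S-AbsX and S-AbsP only forget the labels $(N_p,X)$ and $p$ of the arrow, respectively. - F-Recover: if some processor is in a failed state $\langle a,\mathtt{fl}\rangle$ then $c\Rightarrow\mathrm{lcs}(c)$ (when $\mathrm{lcs}(c)$ is defined). **Auxiliary functions**, for $c=\langle\Pi,\Sigma,N,M,M_0\rangle$. Greatest common epoch: $\mathrm{gce}(c)=\min\{\max(\mathrm{dom}(a)) : \Sigma_p=\langle a,\sigma_V\rangle\}$ (minimum over all processors $p$). Output messages: $\mathrm{out}(c)=\{n\,s\,\langle e,d\rangle\in M : e\le\mathrm{gce}(c)\}$. Let $M\downarrow s$ be the subset of messages of $M$ on stream $s$. Latest common snapshot: $\mathrm{lcs}(c)=\langle\Pi,\Sigma',N',M_0\cup\mathrm{out}(c),M_0\rangle$ where, if $\Sigma_p=\langle a,\sigma_V\rangle$, then $\Sigma'_p=\langle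 a|_{\{e\le\mathrm{gce}(c)\}},\langle\mathrm{gce}(c)+1,a(\mathrm{gce}(c))\rangle\rangle$, and $N'_p(s)=|\mathrm{out}(c)\downarrow s|$ for each $s\in\mathrm{dom}(N_p)$. **Executions.** For a set of rules $R$, $\mathbb E_{c}^{R}$ is the set of nonempty finite or infinite sequences of configurations $C$ with $C_0=c$ and with each unlabelled step $C_{i-1}\Rightarrow C_i$ ($0<i<|C|$) derivable using the rules in $R$. **Valid initial configurations.** $K$ is the set of configurations $\langle\Pi,\Sigma,N,M,M_0\rangle$ such that: each stream is the output stream of at most one task, the input streams of each task are pairwise distinct, and the graph defined by $\Pi$ (tasks connected by streams) is acyclic; the functions $f$ of the tasks only output finite sequences; each state is $\Sigma_p=\langle[0\mapsto v_p],\langle1,v_p\rangle\rangle$ for some value $v_p$; each $N_p$ is defined exactly on the input streams and the output stream of $p$ and is constantly $0$; $M_0=M$; and $M$ consists of well-formed inputs: it contains messages only on source streams (streams that are not the output of any task), on each source stream the messages have contiguous sequence numbers $0,1,2,\dots$ (one message per number), and in this order they form consecutive epochs numbered $1,2,3,\dots$, where an epoch $e$ is a finite sequence of event messages with epoch number $e$ followed by one border $\langle e,\mathtt{BD}\rangle$; all source streams contain the same (finite or infinite) collection of epochs. **Failure transparency.** A set of rules $R$ is failure transparent with respect to $F\subseteq R$ for an observability function $O$ (a function from configurations to observable outputs, monotone along steps of $R$ for some partial order) and a set $K$ of initial configurations iff for every $c\in K$ and $C\in\mathbb E_c^R$ there is $C'\in\mathbb E_c^{R\setminus F}$ such that for every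 index $m$ of $C$ there is an index $m'$ of $C'$ with $O(C_m)=O(C'_{m'})$. *)

theory Defs
  imports Main "HOL-Library.Extended_Nat" "HOL-Library.Finite_Map"
begin

section \<open>Finite and infinite sequences\<close>

text \<open>Sequences that are always finite (processors, input stream names, action sequences) are
  plain lists; \<open>seq\<close> is used where infinite length is allowed.\<close>

datatype 'a seq = Fin "'a list" | Inf "nat \<Rightarrow> 'a"

fun slen :: "'a seq \<Rightarrow> enat" where
  "slen (Fin xs) = enat (length xs)"
| "slen (Inf g) = \<infinity>"

fun snth :: "'a seq \<Rightarrow> nat \<Rightarrow> 'a" where
  "snth (Fin xs) i = xs ! i"
| "snth (Inf g) i = g i"


section \<open>Configurations\<close>

text \<open>Type variables: \<open>'s\<close> stream names, \<open>'v\<close> state values, \<open>'w\<close> event values.\<close>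

datatype ('s, 'v, 'w) task =
  TK (tfun: "'v \<Rightarrow> 'w \<Rightarrow> 'v \<times> 'w seq") (ins: "'s list") (outs: 's)

datatype 'v volatile = Failed | Normal nat 'v

type_synonym 'v state = "(nat, 'v) fmap \<times> 'v volatile"

datatype 'w data = EV 'w | BD

datatype ('s, 'w) msg = Msg (seqno: nat) (strm: 's) (body: "nat \<times> 'w data")

abbreviation epoch_of :: "('s, 'w) msg \<Rightarrow> nat" where
  "epoch_of m \<equiv> fst (body m)"

datatype ('s, 'v, 'w) config =
  Config (procs: "('s, 'v, 'w) task list") (states: "'v state list")
    (nums: "('s \<rightharpoonup> nat) list") (msgs: "('s, 'w) msg set") (init_msgs: "('s, 'w) msg set")

text \<open>\<open>states\<close> and \<open>nums\<close> are indexed by processor, i.e. by position in \<open>procs\<close>.\<close>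

definition wf_config :: "('s, 'v, 'w) config \<Rightarrow> bool" where
  "wf_config c \<longleftrightarrow> procs c \<noteq> [] \<and>
     length (states c) = length (procs c) \<and> length (nums c) = length (procs c) \<and>
     (\<forall>p < length (procs c).
        dom (nums c ! p) = set (ins (procs c ! p)) \<union> {outs (procs c ! p)})"


section \<open>Actions\<close>

datatype ('s, 'w) action = Produce 's "nat \<times> 'w data" | Consume 's "nat \<times> 'w data"

fun apply_action ::
  "('s, 'w) action \<Rightarrow> ('s \<rightharpoonup> nat) \<times> ('s, 'w) msg set \<Rightarrow>
   (('s \<rightharpoonup> nat) \<times> ('s, 'w) msg set) option" where
  "apply_action (Produce s \<delta>) (N, M) =
     (case N s of None \<Rightarrow> None
      | Some n \<Rightarrow> Some (N(s \<mapsto> n + 1), M \<union> {Msg n s \<delta>}))"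
| "apply_action (Consume s \<delta>) (N, M) =
     (case N s of None \<Rightarrow> None
      | Some n \<Rightarrow> if Msg n s \<delta> \<in> M then Some (N(s \<mapsto> n + 1), M) else None)"

fun apply_actions ::
  "('s, 'w) action list \<Rightarrow> ('s \<rightharpoonup> nat) \<times> ('s, 'w) msg set \<Rightarrow>
   (('s \<rightharpoonup> nat) \<times> ('s, 'w) msg set) option" where
  "apply_actions [] NM = Some NM"
| "apply_actions (x # X) NM = Option.bind (apply_action x NM) (apply_actions X)"


section \<open>Output messages and the latest common snapshot\<close>

text \<open>The greatest common epoch is undefined if some archive is empty. This never happens in a
  configuration reachable from a valid initial one.\<close>

definition gce :: "('s, 'v, 'w) config \<Rightarrow> nat option" where
  "gce c =
     (if \<forall>(a, \<sigma>V) \<in> set (states c). fmdom' a \<noteq> {}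
      then Some (Min ((\<lambda>(a, \<sigma>V). Max (fmdom' a)) ` set (states c)))
      else None)"

text \<open>By convention there are no output messages where the greatest common epoch is undefined.\<close>

definition out :: "('s, 'v, 'w) config \<Rightarrow> ('s, 'w) msg set" where
  "out c = {m \<in> msgs c. \<exists>g. gce c = Some g \<and> epoch_of m \<le> g}"

definition on_stream :: "('s, 'w) msg set \<Rightarrow> 's \<Rightarrow> ('s, 'w) msg set" where
  "on_stream M s = {m \<in> M. strm m = s}"

text \<open>The latest common snapshot is undefined if the greatest common epoch is, if some archive has
  no entry for it, or if one of the new sequence numbers would be infinite.\<close>

definition lcs :: "('s, 'v, 'w) config \<Rightarrow> ('s, 'v, 'w) config option" where
  "lcs c = (case gce c of None \<Rightarrow> None
     | Some g \<Rightarrow>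
        if (\<forall>(a, \<sigma>V) \<in> set (states c). g \<in> fmdom' a) \<and>
           (\<forall>N \<in> set (nums c). \<forall>s \<in> dom N. finite (on_stream (out c) s))
        then Some (Config (procs c)
          (map (\<lambda>(a, \<sigma>V). (fmfilter (\<lambda>e. e \<le> g) a, Normal (g + 1) (the (fmlookup a g)))) (states c))
          (map (\<lambda>N s. if s \<in> dom N then Some (card (on_stream (out c) s)) else None) (nums c))
          (init_msgs c \<union> out c)
          (init_msgs c))
        else None)"


section \<open>Rules\<close>

text \<open>The step relations are parameterised by the set of rules that derivations may use.\<close>

datatype rule = S_Step | S_AbsX | S_AbsP | I_Event | I_Border | F_Fail | F_Recover

inductive local_step ::
  "rule set \<Rightarrow> ('s, 'v, 'w) task \<Rightarrow> 'v state \<Rightarrow> ('s, 'w) action list \<Rightarrow> 'v state \<Rightarrow> bool"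
  for R where
  I_Event:
    "\<lbrakk>I_Event \<in> R; f v w = (v', Fin W'); j < length S\<rbrakk> \<Longrightarrow>
     local_step R (TK f S o') (a, Normal e v)
       (Consume (S ! j) (e, EV w) # map (\<lambda>w'. Produce o' (e, EV w')) W')
       (a, Normal e v')"
| I_Border:
    "I_Border \<in> R \<Longrightarrow>
     local_step R (TK f S o') (a, Normal e v)
       (map (\<lambda>s. Consume s (e, BD)) S @ [Produce o' (e, BD)])
       (fmupd e v a, Normal (e + 1) v)"
| F_Fail:
    "F_Fail \<in> R \<Longrightarrow> local_step R (TK f S o') (a, \<sigma>V) [] (a, Failed)"

text \<open>The arrow labelled by \<open>p\<close>, \<open>N\<^sub>p\<close>, \<open>X\<close>; then the one labelled by \<open>p\<close> only; then the unlabelled one.\<close>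

inductive step_full ::
  "rule set \<Rightarrow> ('s, 'v, 'w) config \<Rightarrow> nat \<Rightarrow> ('s \<rightharpoonup> nat) \<Rightarrow> ('s, 'w) action list \<Rightarrow>
   ('s, 'v, 'w) config \<Rightarrow> bool"
  for R where
  S_Step:
    "\<lbrakk>S_Step \<in> R; p < length \<Pi>; local_step R (\<Pi> ! p) (\<Sigma> ! p) X \<sigma>';
      apply_actions X (N ! p, M) = Some (N', M')\<rbrakk> \<Longrightarrow>
     step_full R (Config \<Pi> \<Sigma> N M M0) p (N ! p) X (Config \<Pi> (\<Sigma>[p := \<sigma>']) (N[p := N']) M' M0)"

inductive step_proc ::
  "rule set \<Rightarrow> ('s, 'v, 'w) config \<Rightarrow> nat \<Rightarrow> ('s, 'v, 'w) config \<Rightarrow> bool"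
  for R where
  S_AbsX: "\<lbrakk>S_AbsX \<in> R; step_full R c p Np X c'\<rbrakk> \<Longrightarrow> step_proc R c p c'"

inductive step :: "rule set \<Rightarrow> ('s, 'v, 'w) config \<Rightarrow> ('s, 'v, 'w) config \<Rightarrow> bool"
  for R where
  S_AbsP: "\<lbrakk>S_AbsP \<in> R; step_proc R c p c'\<rbrakk> \<Longrightarrow> step R c c'"
| F_Recover:
    "\<lbrakk>F_Recover \<in> R; (a, Failed) \<in> set (states c); lcs c = Some c'\<rbrakk> \<Longrightarrow> step R c c'"

definition failure_rules :: "rule set" where
  "failure_rules = {F_Fail, F_Recover}"

definition impl_rules :: "rule set" where
  "impl_rules = {S_Step, S_AbsX, S_AbsP, I_Event, I_Border} \<union> failure_rules"

definition executions :: "rule set \<Rightarrow> ('s, 'v, 'w) config \<Rightarrow> ('s, 'v, 'w) config seq set" where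
  "executions R c =
     {C. 0 < slen C \<and> snth C 0 = c \<and>
         (\<forall>i. 0 < i \<and> enat i < slen C \<longrightarrow> step R (snth C (i - 1)) (snth C i))}"


section \<open>Valid initial configurations\<close>

definition task_graph :: "('s, 'v, 'w) task list \<Rightarrow> (nat \<times> nat) set" where
  "task_graph \<Pi> =
     {(p, q). p < length \<Pi> \<and> q < length \<Pi> \<and> outs (\<Pi> ! p) \<in> set (ins (\<Pi> ! q))}"

definition valid_graph :: "('s, 'v, 'w) task list \<Rightarrow> bool" where
  "valid_graph \<Pi> \<longleftrightarrow>
     (\<forall>p < length \<Pi>. \<forall>q < length \<Pi>. outs (\<Pi> ! p) = outs (\<Pi> ! q) \<longrightarrow> p = q) \<and>
     (\<forall>\<pi> \<in> set \<Pi>. distinct (ins \<pi>)) \<and>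
     acyclic (task_graph \<Pi>)"

text \<open>Only streams that occur in the graph count as source streams.\<close>

definition sources :: "('s, 'v, 'w) task list \<Rightarrow> 's set" where
  "sources \<Pi> = (\<Union>\<pi> \<in> set \<Pi>. set (ins \<pi>)) - outs ` set \<Pi>"

definition epoch :: "nat \<Rightarrow> 'w list \<Rightarrow> (nat \<times> 'w data) list" where
  "epoch e ws = map (\<lambda>w. (e, EV w)) ws @ [(e, BD)]"

definition epochs_upto :: "(nat \<Rightarrow> 'w list) \<Rightarrow> nat \<Rightarrow> (nat \<times> 'w data) list" where
  "epochs_upto ws k = concat (map (\<lambda>e. epoch e (ws e)) [1..<k + 1])"

text \<open>\<open>E\<close> is the (finite or infinite) number of epochs, common to all source streams; \<open>ws e\<close> lists
  the events of epoch \<open>e\<close> and may differ from stream to stream.\<close>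

definition wf_inputs :: "('s, 'v, 'w) task list \<Rightarrow> ('s, 'w) msg set \<Rightarrow> bool" where
  "wf_inputs \<Pi> M \<longleftrightarrow>
     (\<forall>m \<in> M. strm m \<in> sources \<Pi>) \<and>
     (\<exists>E :: enat. \<forall>s \<in> sources \<Pi>. \<exists>ws.
        on_stream M s =
          {Msg n s (epochs_upto ws k ! n) | n k. enat k \<le> E \<and> n < length (epochs_upto ws k)})"

definition valid_init :: "('s, 'v, 'w) config set" where
  "valid_init =
     {c. wf_config c \<and>
         valid_graph (procs c) \<and>
         (\<forall>\<pi> \<in> set (procs c). \<forall>v w. slen (snd (tfun \<pi> v w)) < \<infinity>) \<and>
         (\<forall>\<sigma> \<in> set (states c). \<exists>v. \<sigma> = (fmupd 0 v fmempty, Normal 1 v)) \<and>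
         (\<forall>N \<in> set (nums c). \<forall>s \<in> dom N. N s = Some 0) \<and>
         init_msgs c = msgs c \<and>
         wf_inputs (procs c) (msgs c)}"


section \<open>Observability and failure transparency\<close>

definition observability_function :: "rule set \<Rightarrow> (('s, 'v, 'w) config \<Rightarrow> 'o) \<Rightarrow> bool" where
  "observability_function R Obs \<longleftrightarrow>
     (\<exists>r. partial_order_on UNIV r \<and>
          (\<forall>c c'. wf_config c \<and> step R c c' \<longrightarrow> (Obs c, Obs c') \<in> r))"

definition failure_transparent ::
  "rule set \<Rightarrow> rule set \<Rightarrow> (('s, 'v, 'w) config \<Rightarrow> 'o) \<Rightarrow> ('s, 'v, 'w) config set \<Rightarrow> bool" where
  "failure_transparent R F Obs K \<longleftrightarrow>
     F \<subseteq> R \<and> observability_function R Obs \<and>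
     (\<forall>c \<in> K. \<forall>C \<in> executions R c. \<exists>C' \<in> executions (R - F) c.
        \<forall>m. enat m < slen C \<longrightarrow>
          (\<exists>m'. enat m' < slen C' \<and> Obs (snth C m) = Obs (snth C' m')))"

end

theory Submission
  imports Defs
begin

text \<open>The configurations \<open>L m\<close> = lcs of the \<open>m\<close>-th configuration of the given execution have
  the same outputs as that execution, and failures and recoveries do not change them. It therefore
  suffices that each \<open>L m\<close> leads to \<open>L (m + 1)\<close> by failure-free steps: concatenating these runs
  gives the failure-free execution. When a step raises the greatest common epoch to \<open>h\<close>, take the
  failure-free run from the old snapshot to the new configuration and postpone all steps that belong
  to epochs after \<open>h\<close>. This is possible because steps of different processors commute and the
  steps of one processor are ordered by epoch. The first part of the reordered run ends in the new
  snapshot.\<close>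

section \<open>Runs of actions\<close>

text \<open>The execution \<open>C\<close> cannot be imitated step by step: after a recovery it may
  redo the work of an epoch in another order and with other results, so work beyond the snapshot
  must not be copied before it is known to last. Snapshots only move forward, so they are what is
  imitated. The obstacle is that processors work in different epochs at the same time, so
  \<open>C\<close> may never pass through the new snapshot; the reordering produces it. The delicate
  point is the sequence numbers: \<open>lcs\<close> recomputes them by counting messages, whereas
  the reordered run obtains them by executing actions. Both agree because on each stream the epochs
  follow each other without gaps and are closed by borders; the stream invariants record just that.
  There is a failure-free run to reorder although processors of \<open>C\<close> may have failed: a
  failure destroys only a volatile state, and giving it back (\<open>healed\<close>) yields a
  configuration with the same snapshot that is reachable from this snapshot without
  failures.\<close>

fun action_body :: "('s, 'w) action \<Rightarrow> nat \<times> 'w data" where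
  "action_body (Produce s \<delta>) = \<delta>"
| "action_body (Consume s \<delta>) = \<delta>"

lemma apply_action_dom:
  "apply_action x (N, M) = Some (N', M') \<Longrightarrow> dom N' = dom N"
  by (cases x) (auto split: option.splits if_splits)

lemma apply_actions_dom:
  "apply_actions X (N, M) = Some (N', M') \<Longrightarrow> dom N' = dom N"
proof (induction X arbitrary: N M)
  case (Cons x X)
  then obtain N1 M1 where "apply_action x (N, M) = Some (N1, M1)"
    "apply_actions X (N1, M1) = Some (N', M')"
    by (auto simp: bind_eq_Some_conv)
  with Cons.IH show ?case
    by (metis apply_action_dom)
qed auto

lemma apply_actions_append:
  "apply_actions (X @ Y) NM = Option.bind (apply_actions X NM) (apply_actions Y)"
proof (induction X arbitrary: NM)
  case (Cons x X)
  then have "apply_actions (X @ Y) = (\<lambda>NM. Option.bind (apply_actions X NM) (apply_actions Y))"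
    by blast
  then show ?case by simp
qed simp

text \<open>This is why steps of different processors commute and why a step up to epoch \<open>h\<close> can be
  replayed after the messages of later epochs have been removed.\<close>

lemma apply_actions_frame:
  assumes "apply_actions X (N, M) = Some (N', M')"
  obtains \<Delta> where "M' = M \<union> \<Delta>"
    "\<And>m. m \<in> \<Delta> \<Longrightarrow> Produce (strm m) (body m) \<in> set X"
    "\<And>M2. {m \<in> M. body m \<in> action_body ` set X} \<subseteq> M2 \<Longrightarrow>
       apply_actions X (N, M2) = Some (N', M2 \<union> \<Delta>)"
  using assms
proof (induction X arbitrary: N M thesis)
  case Nil
  from Nil.prems(1)[of "{}"] Nil.prems(2) show ?case
    by auto
next
  case (Cons x X)
  from Cons.prems(2) obtain N1 M1 where x: "apply_action x (N, M) = Some (N1, M1)"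
    and X: "apply_actions X (N1, M1) = Some (N', M')"
    by (auto simp: bind_eq_Some_conv)
  obtain \<Delta>1 where D1: "M1 = M \<union> \<Delta>1"
    "\<And>m. m \<in> \<Delta>1 \<Longrightarrow> Produce (strm m) (body m) = x"
    "\<And>M2. {m \<in> M. body m = action_body x} \<subseteq> M2 \<Longrightarrow>
       apply_action x (N, M2) = Some (N1, M2 \<union> \<Delta>1)"
  proof (cases x)
    case (Produce s \<delta>)
    with x obtain n where "N s = Some n" "N1 = N(s \<mapsto> n + 1)" "M1 = M \<union> {Msg n s \<delta>}"
      by (auto split: option.splits)
    with Produce that[of "{Msg n s \<delta>}"] show ?thesis
      by auto
  next
    case (Consume s \<delta>)
    with x obtain n where "N s = Some n" "N1 = N(s \<mapsto> n + 1)" "Msg n s \<delta> \<in> M" "M1 = M"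
      by (auto split: option.splits if_splits)
    moreover from this Consume
    have "apply_action x (N, M2) = Some (N1, M2)" if "{m \<in> M. body m = action_body x} \<subseteq> M2" for M2
      using that by auto
    ultimately show ?thesis
      using Consume that[of "{}"] by simp
  qed
  obtain \<Delta>2 where D2: "M' = M1 \<union> \<Delta>2"
    "\<And>m. m \<in> \<Delta>2 \<Longrightarrow> Produce (strm m) (body m) \<in> set X"
    "\<And>M2. {m \<in> M1. body m \<in> action_body ` set X} \<subseteq> M2 \<Longrightarrow>
       apply_actions X (N1, M2) = Some (N', M2 \<union> \<Delta>2)"
    by (rule Cons.IH[OF _ X]) blast
  show ?case
  proof (rule Cons.prems(1)[of "\<Delta>1 \<union> \<Delta>2"])
    show "M' = M \<union> (\<Delta>1 \<union> \<Delta>2)"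
      using D1(1) D2(1) by auto
    show "Produce (strm m) (body m) \<in> set (x # X)" if "m \<in> \<Delta>1 \<union> \<Delta>2" for m
      using that D1(2) D2(2) by auto
    fix M2
    assume M2: "{m \<in> M. body m \<in> action_body ` set (x # X)} \<subseteq> M2"
    then have "apply_action x (N, M2) = Some (N1, M2 \<union> \<Delta>1)"
      by (intro D1(3)) auto
    moreover have "apply_actions X (N1, M2 \<union> \<Delta>1) = Some (N', (M2 \<union> \<Delta>1) \<union> \<Delta>2)"
      using M2 D1(1) by (intro D2(3)) auto
    ultimately show "apply_actions (x # X) (N, M2) = Some (N', M2 \<union> (\<Delta>1 \<union> \<Delta>2))"
      by (simp add: Un_assoc)
  qed
qed


section \<open>Failure-free steps\<close>

definition normal_rules :: "rule set" where
  "normal_rules = {S_Step, S_AbsX, S_AbsP, I_Event, I_Border}"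

lemma normal_rules_eq: "impl_rules - failure_rules = normal_rules"
  by (auto simp: impl_rules_def failure_rules_def normal_rules_def)

text \<open>The label contains the new local state as well, which makes a labelled step deterministic.\<close>

definition pstep ::
  "rule set \<Rightarrow> nat \<Rightarrow> ('s, 'w) action list \<Rightarrow> 'v state \<Rightarrow> ('s, 'v, 'w) config \<Rightarrow>
   ('s, 'v, 'w) config \<Rightarrow> bool" where
  "pstep R p X \<sigma>' c c' \<longleftrightarrow> p < length (procs c) \<and>
     local_step R (procs c ! p) (states c ! p) X \<sigma>' \<and>
     (\<exists>N' M'. apply_actions X (nums c ! p, msgs c) = Some (N', M') \<and>
        c' = Config (procs c) ((states c)[p := \<sigma>']) ((nums c)[p := N']) M' (init_msgs c))"

lemma step_cases:
  assumes "step R c c'"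
  obtains (proc) p X \<sigma>' where "pstep R p X \<sigma>' c c'"
  | (recover) a where "(a, Failed) \<in> set (states c)" "lcs c = Some c'"
  using assms
proof cases
  case (S_AbsP p)
  then show ?thesis
    by (elim step_proc.cases step_full.cases) (auto intro!: proc simp: pstep_def)
qed (use recover in auto)

lemma pstep_imp_step: "pstep normal_rules p X \<sigma>' c c' \<Longrightarrow> step normal_rules c c'"
  unfolding pstep_def
  by (cases c)
    (auto simp: normal_rules_def
      intro!: step.S_AbsP step_proc.S_AbsX step_full.S_Step)

lemma pstep_deterministic:
  "pstep R p X \<sigma>' c c1 \<Longrightarrow> pstep R p X \<sigma>' c c2 \<Longrightarrow> c1 = c2"
  by (auto simp: pstep_def)

text \<open>Processors share only the message set, and no step removes a message: a consumption that
  is enabled stays enabled, and each step adds the same messages in either order.\<close>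

lemma pstep_diamond:
  assumes "pstep R p X \<sigma> c c1" "pstep R q Y \<tau> c c2" "p \<noteq> q"
  shows "\<exists>c3. pstep R q Y \<tau> c1 c3 \<and> pstep R p X \<sigma> c2 c3"
proof -
  obtain N1 M1 where 1: "apply_actions X (nums c ! p, msgs c) = Some (N1, M1)"
    "c1 = Config (procs c) ((states c)[p := \<sigma>]) ((nums c)[p := N1]) M1 (init_msgs c)"
    using assms by (auto simp: pstep_def)
  obtain N2 M2 where 2: "apply_actions Y (nums c ! q, msgs c) = Some (N2, M2)"
    "c2 = Config (procs c) ((states c)[q := \<tau>]) ((nums c)[q := N2]) M2 (init_msgs c)"
    using assms by (auto simp: pstep_def)
  obtain \<Delta>1 where D1: "M1 = msgs c \<union> \<Delta>1"
    "\<And>M. {m \<in> msgs c. body m \<in> action_body ` set X} \<subseteq> M \<Longrightarrow>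
       apply_actions X (nums c ! p, M) = Some (N1, M \<union> \<Delta>1)"
    by (rule apply_actions_frame[OF 1(1)]) blast
  obtain \<Delta>2 where D2: "M2 = msgs c \<union> \<Delta>2"
    "\<And>M. {m \<in> msgs c. body m \<in> action_body ` set Y} \<subseteq> M \<Longrightarrow>
       apply_actions Y (nums c ! q, M) = Some (N2, M \<union> \<Delta>2)"
    by (rule apply_actions_frame[OF 2(1)]) blast
  have "apply_actions Y (nums c ! q, M1) = Some (N2, M1 \<union> \<Delta>2)"
    using D1(1) by (intro D2(2)) auto
  moreover have "apply_actions X (nums c ! p, M2) = Some (N1, M2 \<union> \<Delta>1)"
    using D2(1) by (intro D1(2)) auto
  then have "apply_actions X (nums c ! p, M2) = Some (N1, M1 \<union> \<Delta>2)"
    using D1(1) D2(1) by (simp add: Un_ac)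
  ultimately show ?thesis
    using assms 1(2) 2(2)
    by (intro exI[of _ "Config (procs c) ((states c)[p := \<sigma>, q := \<tau>])
          ((nums c)[p := N1, q := N2]) (M1 \<union> \<Delta>2) (init_msgs c)"])
      (auto simp: pstep_def list_update_swap)
qed

text \<open>The set \<open>A\<close> records which processors may move; this is all one has to know
  in order to commute a step of another processor with the whole run.\<close>

definition run_by :: "nat set \<Rightarrow> ('s, 'v, 'w) config \<Rightarrow> ('s, 'v, 'w) config \<Rightarrow> bool" where
  "run_by A = (\<lambda>c c'. \<exists>q\<in>A. \<exists>Y \<tau>. pstep normal_rules q Y \<tau> c c')\<^sup>*\<^sup>*"

lemma run_by_mono: "run_by A c c' \<Longrightarrow> A \<subseteq> B \<Longrightarrow> run_by B c c'"
  unfolding run_by_def by (rule rtranclp_mono[THEN predicate2D]) auto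

lemma run_by_refl: "run_by A c c"
  by (simp add: run_by_def)

lemma run_by_step:
  "run_by A c c' \<Longrightarrow> pstep normal_rules q Y \<tau> c' c'' \<Longrightarrow> q \<in> A \<Longrightarrow> run_by A c c''"
  unfolding run_by_def by (erule rtranclp.rtrancl_into_rtrancl) blast

lemma run_by_imp_steps: "run_by A c c' \<Longrightarrow> (step normal_rules)\<^sup>*\<^sup>* c c'"
  unfolding run_by_def
  by (rule rtranclp_mono[THEN predicate2D]) (auto intro: pstep_imp_step)

text \<open>Squares of \<open>pstep_diamond\<close> are lined up along the run.\<close>

lemma run_by_strip:
  assumes "run_by A x c" "p \<notin> A" "pstep normal_rules p X \<sigma> x x'"
  shows "\<exists>c'. pstep normal_rules p X \<sigma> c c' \<and> run_by A x' c'"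
  using assms(1) unfolding run_by_def
proof (induction rule: rtranclp_induct)
  case base
  with assms(3) show ?case by auto
next
  case (step y z)
  then obtain q Y \<tau> y' where "q \<in> A" "pstep normal_rules q Y \<tau> y z"
    "pstep normal_rules p X \<sigma> y y'"
    "(\<lambda>c c'. \<exists>q\<in>A. \<exists>Y \<tau>. pstep normal_rules q Y \<tau> c c')\<^sup>*\<^sup>* x' y'"
    by auto
  with pstep_diamond[of normal_rules p X \<sigma> y y' q Y \<tau> z] assms(2) show ?case
    by (metis (no_types, lifting) rtranclp.rtrancl_into_rtrancl)
qed

section \<open>Shape of the local steps\<close>

lemma local_step_normal_cases:
  assumes "local_step normal_rules \<pi> \<sigma> X \<sigma>'"
  obtains (event) a e v v' w W' s where "\<sigma> = (a, Normal e v)" "\<sigma>' = (a, Normal e v')"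
    "s \<in> set (ins \<pi>)"
    "X = Consume s (e, EV w) # map (\<lambda>w'. Produce (outs \<pi>) (e, EV w')) W'"
  | (border) a e v where "\<sigma> = (a, Normal e v)" "\<sigma>' = (fmupd e v a, Normal (e + 1) v)"
    "X = map (\<lambda>s. Consume s (e, BD)) (ins \<pi>) @ [Produce (outs \<pi>) (e, BD)]"
  using assms by cases (auto simp: normal_rules_def)

text \<open>No step straddles an epoch boundary: even a border step, which moves the state to
  \<open>e + 1\<close>, acts only on messages of epoch \<open>e\<close>. Hence a cut at an epoch
  keeps or drops a step as a whole.\<close>

lemma local_step_normal:
  assumes "local_step normal_rules \<pi> (a, Normal e v) X \<sigma>'"
  shows "\<And>x. x \<in> set X \<Longrightarrow> fst (action_body x) = e"
    and "\<And>s \<delta>. Produce s \<delta> \<in> set X \<Longrightarrow> s = outs \<pi>"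
  using assms by (cases rule: local_step_normal_cases; force)+

lemma local_step_impl_cases:
  assumes "local_step impl_rules \<pi> \<sigma> X \<sigma>'"
  obtains (normal) "local_step normal_rules \<pi> \<sigma> X \<sigma>'"
  | (fail) "X = []" "\<sigma>' = (fst \<sigma>, Failed)"
  using assms
proof cases
  case (I_Event f v w v' W' j S o' e a)
  then show ?thesis
    using normal by (auto simp: normal_rules_def intro!: local_step.I_Event)
next
  case (I_Border f S o' a e v)
  then show ?thesis
    using normal local_step.I_Border[of normal_rules f S o' a e v]
    by (auto simp: normal_rules_def)
qed (use fail in auto)


section \<open>Monotonicity of the output\<close>

lemma gce_cong: "map fst (states c) = map fst (states c') \<Longrightarrow> gce c = gce c'"
proof -
  have *: "gce c = (if \<forall>a \<in> set (map fst (states c)). fmdom' a \<noteq> {}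
     then Some (Min ((\<lambda>a. Max (fmdom' a)) ` set (map fst (states c)))) else None)"
    for c :: "('s, 'v, 'w) config"
    unfolding gce_def by (auto simp: image_image case_prod_beta)
  show "map fst (states c) = map fst (states c') \<Longrightarrow> gce c = gce c'"
    unfolding * by metis
qed

lemma gce_SomeD:
  assumes "gce c = Some g" "p < length (states c)"
  shows "fmdom' (fst (states c ! p)) \<noteq> {}" "g \<le> Max (fmdom' (fst (states c ! p)))"
proof -
  have in_set: "states c ! p \<in> set (states c)"
    using assms by auto
  then show "fmdom' (fst (states c ! p)) \<noteq> {}"
    using assms(1) by (fastforce simp: gce_def split: if_splits)
  have "g = Min ((\<lambda>\<sigma>. Max (fmdom' (fst \<sigma>))) ` set (states c))"
    using assms(1) by (auto simp: gce_def case_prod_beta split: if_splits)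
  then show "g \<le> Max (fmdom' (fst (states c ! p)))"
    using in_set by auto
qed

lemma gce_SomeI:
  assumes "states c \<noteq> []" "\<And>p. p < length (states c) \<Longrightarrow> fmdom' (fst (states c ! p)) \<noteq> {}"
    "\<And>p. p < length (states c) \<Longrightarrow> g \<le> Max (fmdom' (fst (states c ! p)))"
  obtains g' where "gce c = Some g'" "g \<le> g'"
proof -
  have "\<forall>\<sigma> \<in> set (states c). fmdom' (fst \<sigma>) \<noteq> {}"
    "\<forall>\<sigma> \<in> set (states c). g \<le> Max (fmdom' (fst \<sigma>))"
    using assms by (metis in_set_conv_nth)+
  with assms(1) show ?thesis
    by (intro that[of "Min ((\<lambda>\<sigma>. Max (fmdom' (fst \<sigma>))) ` set (states c))"])
      (auto simp: gce_def case_prod_beta)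
qed

lemma gce_const:
  assumes "states c \<noteq> []" "\<And>p. p < length (states c) \<Longrightarrow> fmdom' (fst (states c ! p)) \<noteq> {}"
    "\<And>p. p < length (states c) \<Longrightarrow> Max (fmdom' (fst (states c ! p))) = g"
  shows "gce c = Some g"
proof -
  have "\<forall>\<sigma> \<in> set (states c). fmdom' (fst \<sigma>) \<noteq> {}"
    "\<forall>\<sigma> \<in> set (states c). Max (fmdom' (fst \<sigma>)) = g"
    using assms by (metis in_set_conv_nth)+
  then have "(\<lambda>\<sigma>. Max (fmdom' (fst \<sigma>))) ` set (states c) = {g}"
    using assms(1) by (cases "states c") force+
  with \<open>\<forall>\<sigma> \<in> set (states c). fmdom' (fst \<sigma>) \<noteq> {}\<close> show ?thesis
    by (auto simp: gce_def case_prod_beta)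
qed

lemma local_step_archive:
  assumes "local_step R \<pi> \<sigma> X \<sigma>'"
  shows "fmdom' (fst \<sigma>) \<subseteq> fmdom' (fst \<sigma>')"
  using assms by cases (auto simp: fmdom'_alt_def)

text \<open>Archives only grow, also under a failure, which discards the volatile state
  alone.\<close>

lemma pstep_gce_mono:
  assumes "wf_config c" "pstep R p X \<sigma>' c c'" "gce c = Some g"
  obtains g' where "gce c' = Some g'" "g \<le> g'"
proof -
  have len: "length (states c) = length (procs c)" "procs c \<noteq> []"
    using assms(1) by (auto simp: wf_config_def)
  have st: "states c' = (states c)[p := \<sigma>']" "fmdom' (fst (states c ! p)) \<subseteq> fmdom' (fst \<sigma>')"
    using assms(2) local_step_archive[of R "procs c ! p" "states c ! p" X \<sigma>']
    by (auto simp: pstep_def)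
  have sub: "fmdom' (fst (states c ! q)) \<subseteq> fmdom' (fst (states c' ! q))"
    if "q < length (states c)" for q
    using st that by (cases "q = p") auto
  have "fmdom' (fst (states c' ! q)) \<noteq> {}" "g \<le> Max (fmdom' (fst (states c' ! q)))"
    if "q < length (states c')" for q
  proof -
    have "q < length (states c)" using that st by auto
    note * = sub[OF this] gce_SomeD[OF assms(3) this]
    then show "fmdom' (fst (states c' ! q)) \<noteq> {}" by auto
    show "g \<le> Max (fmdom' (fst (states c' ! q)))"
      using *(3) Max_mono[OF *(1,2)] by simp
  qed
  moreover have "states c' \<noteq> []"
    using st len by auto
  ultimately show ?thesis
    using gce_SomeI[of c' g] that by blast
qed

lemma pstep_msgs: "pstep R p X \<sigma>' c c' \<Longrightarrow> msgs c \<subseteq> msgs c'"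
  unfolding pstep_def by (auto elim!: apply_actions_frame)

text \<open>Each truncated archive has \<open>g\<close> itself as its largest key.\<close>

lemma gce_lcs:
  assumes "lcs c = Some c'" "states c \<noteq> []"
  shows "gce c' = gce c"
proof -
  from assms obtain g where g: "gce c = Some g" "\<forall>(a, \<sigma>V) \<in> set (states c). g \<in> fmdom' a"
    and st: "states c' = map (\<lambda>(a, \<sigma>V).
      (fmfilter (\<lambda>e. e \<le> g) a, Normal (g + 1) (the (fmlookup a g)))) (states c)"
    by (auto simp: lcs_def split: option.splits if_splits)
  have "gce c' = Some g"
  proof (rule gce_const)
    show "states c' \<noteq> []" using assms st by auto
    fix p assume "p < length (states c')"
    then have "states c ! p \<in> set (states c)" and *: "states c' ! p =
      (fmfilter (\<lambda>e. e \<le> g) (fst (states c ! p)),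
        Normal (g + 1) (the (fmlookup (fst (states c ! p)) g)))"
      using st by (auto simp: case_prod_beta)
    then have "g \<in> fmdom' (fst (states c ! p))"
      using g(2) by fastforce
    then have mem: "g \<in> fmdom' (fst (states c' ! p))"
      "\<forall>e \<in> fmdom' (fst (states c' ! p)). e \<le> g"
      using * by (auto simp: fmdom'_alt_def)
    then show "fmdom' (fst (states c' ! p)) \<noteq> {}" by auto
    show "Max (fmdom' (fst (states c' ! p))) = g"
      using mem by (intro Max_eqI) auto
  qed
  with g show ?thesis by simp
qed

text \<open>Only an inclusion holds for arbitrary configurations: recovery restores
  \<open>init_msgs c\<close>, which need not be contained in \<open>msgs c\<close>. Under the
  invariant, \<open>out_lcs\<close> gives equality.\<close>

lemma lcs_out_subset:
  assumes "lcs c = Some c'" "states c \<noteq> []"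
  shows "out c \<subseteq> out c'"
  using gce_lcs[OF assms] assms(1)
  by (auto simp: lcs_def out_def split: option.splits if_splits)

text \<open>The order is inclusion: a local step only adds messages and does not lower the greatest
  common epoch, and recovery keeps that epoch and all messages up to it.\<close>

lemma observability_out:
  "observability_function R (out :: ('s, 'v, 'w) config \<Rightarrow> ('s, 'w) msg set)"
  unfolding observability_function_def
proof (intro exI conjI allI impI)
  show "partial_order_on UNIV {(A :: ('s, 'w) msg set, B). A \<subseteq> B}"
    by (auto simp: partial_order_on_def preorder_on_def refl_on_def trans_def antisym_def)
  fix c c' :: "('s, 'v, 'w) config"
  assume *: "wf_config c \<and> step R c c'"
  then have "step R c c'" by simp
  then have "out c \<subseteq> out c'"
  proof (cases rule: step_cases)
    case (proc p X \<sigma>')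
    with * show ?thesis
      using pstep_gce_mono[OF _ proc] pstep_msgs[OF proc]
      by (force simp: out_def)
  next
    case (recover a)
    with * show ?thesis
      by (intro lcs_out_subset) (auto simp: wf_config_def)
  qed
  then show "(out c, out c') \<in> {(A, B). A \<subseteq> B}" by simp
qed


section \<open>Streams and epochs\<close>

text \<open>Quantified message bodies \<open>\<delta>\<close> stay whole, so that facts about a body
  as a single object still match.\<close>

declare split_paired_All [simp del] split_paired_Ex [simp del]

text \<open>The epoch expected right after \<open>\<delta>\<close> on a stream.\<close>

definition next_epoch :: "nat \<times> 'w data \<Rightarrow> nat" where
  "next_epoch \<delta> = (if snd \<delta> = BD then Suc (fst \<delta>) else fst \<delta>)"

text \<open>Position \<open>n\<close> may still be empty; its epoch is determined by its
  predecessor. The first position belongs to epoch 1, because epoch 0 is the initial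
  snapshot.\<close>

definition expects :: "('s, 'w) msg set \<Rightarrow> 's \<Rightarrow> nat \<Rightarrow> nat \<Rightarrow> bool" where
  "expects M s n e \<longleftrightarrow>
     (case n of 0 \<Rightarrow> e = 1 | Suc k \<Rightarrow> \<exists>\<delta>. Msg k s \<delta> \<in> M \<and> next_epoch \<delta> = e)"

text \<open>This also excludes gaps: \<open>expects\<close> at position \<open>Suc k\<close> demands
  a message at \<open>k\<close>.\<close>

definition wf_stream :: "('s, 'w) msg set \<Rightarrow> 's \<Rightarrow> bool" where
  "wf_stream M s \<longleftrightarrow>
     (\<forall>n \<delta> \<delta>'. Msg n s \<delta> \<in> M \<longrightarrow> Msg n s \<delta>' \<in> M \<longrightarrow> \<delta> = \<delta>') \<and>
     (\<forall>n \<delta>. Msg n s \<delta> \<in> M \<longrightarrow> expects M s n (fst \<delta>))"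

lemma wf_streamD:
  assumes "wf_stream M s"
  shows "Msg n s \<delta> \<in> M \<Longrightarrow> Msg n s \<delta>' \<in> M \<Longrightarrow> \<delta> = \<delta>'"
    and "Msg n s \<delta> \<in> M \<Longrightarrow> expects M s n (fst \<delta>)"
  using assms unfolding wf_stream_def by blast+

lemma next_epoch_simps [simp]: "next_epoch (e, BD) = Suc e" "next_epoch (e, EV w) = e"
  by (auto simp: next_epoch_def)

lemma fst_le_next_epoch: "fst \<delta> \<le> next_epoch \<delta>"
  by (simp add: next_epoch_def)

lemma expects_mono: "expects M s n e \<Longrightarrow> M \<subseteq> M' \<Longrightarrow> expects M' s n e"
  by (auto simp: expects_def split: nat.splits)

lemma expects_unique:
  "wf_stream M s \<Longrightarrow> expects M s n e \<Longrightarrow> expects M s n e' \<Longrightarrow> e = e'"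
  by (auto simp: expects_def wf_stream_def split: nat.splits)

text \<open>Walk back from position \<open>n\<close>: predecessors exist and epochs do not increase
  on the way. Bounding \<open>next_epoch\<close> instead of the epoch of the message is what
  \<open>consumer_epoch_le\<close> needs, since a reader's epoch is the \<open>next_epoch\<close> of
  the last message before its counter.\<close>

lemma expects_before:
  assumes "wf_stream M s" "expects M s n e" "k < n"
  shows "\<exists>\<delta>. Msg k s \<delta> \<in> M \<and> next_epoch \<delta> \<le> e"
  using assms(2,3)
proof (induction n arbitrary: e)
  case (Suc n)
  then obtain \<delta> where \<delta>: "Msg n s \<delta> \<in> M" "next_epoch \<delta> = e"
    by (auto simp: expects_def)
  show ?case
  proof (cases "k = n")
    case False
    then have "k < n" using Suc.prems by simp
    from Suc.IH[OF wf_streamD(2)[OF assms(1) \<delta>(1)] this] show ?thesis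
      using fst_le_next_epoch[of \<delta>] \<delta>(2) by (metis order_trans)
  qed (use \<delta> in auto)
qed simp

lemma expects_after:
  assumes "wf_stream M s" "expects M s n e" "Msg k s \<delta> \<in> M" "n \<le> k"
  shows "e \<le> fst \<delta>"
  using assms(3,4)
proof (induction k arbitrary: \<delta>)
  case 0
  with assms expects_unique[OF assms(1,2) wf_streamD(2)] show ?case by auto
next
  case (Suc k)
  show ?case
  proof (cases "n = Suc k")
    case True
    with assms Suc.prems expects_unique[OF assms(1,2) wf_streamD(2)] show ?thesis by auto
  next
    case False
    from wf_streamD(2)[OF assms(1) Suc.prems(1)] obtain \<delta>' where
      "Msg k s \<delta>' \<in> M" "next_epoch \<delta>' = fst \<delta>"
      by (auto simp: expects_def)
    with Suc.IH[of \<delta>'] False Suc.prems fst_le_next_epoch[of \<delta>'] show ?thesis by simp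
  qed
qed

text \<open>The stream is complete up to epoch \<open>h\<close>, and \<open>n\<close> is the first
  position after it. By \<open>epoch_end_card\<close> this \<open>n\<close> is the count taken by
  \<open>lcs\<close>, so it links counters that were reached by running to counters that were
  computed.\<close>

definition epoch_end :: "('s, 'w) msg set \<Rightarrow> 's \<Rightarrow> nat \<Rightarrow> nat \<Rightarrow> bool" where
  "epoch_end M s h n \<longleftrightarrow>
     (\<forall>k \<delta>. Msg k s \<delta> \<in> M \<longrightarrow> (fst \<delta> \<le> h \<longleftrightarrow> k < n)) \<and> (\<forall>k<n. \<exists>\<delta>. Msg k s \<delta> \<in> M)"

text \<open>Behind the border the stream expects \<open>Suc h\<close>, so all later messages lie
  beyond \<open>h\<close>; those before it are of epoch at most \<open>h\<close> because epochs
  never decrease.\<close>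

lemma epoch_end_border:
  assumes "wf_stream M s" "Msg k s (h, BD) \<in> M"
  shows "epoch_end M s h (Suc k)"
  unfolding epoch_end_def
proof (intro conjI allI impI)
  have exp: "expects M s (Suc k) (Suc h)"
    using assms(2) by (force simp: expects_def next_epoch_def)
  show "\<exists>\<delta>. Msg j s \<delta> \<in> M" if "j < Suc k" for j
    using expects_before[OF assms(1) exp that] by auto
  fix j \<delta> assume j: "Msg j s \<delta> \<in> M"
  show "fst \<delta> \<le> h \<longleftrightarrow> j < Suc k"
  proof
    assume "fst \<delta> \<le> h"
    with expects_after[OF assms(1) exp j] show "j < Suc k" by force
  next
    assume "j < Suc k"
    then consider "j = k" | "j < k" by linarith
    then show "fst \<delta> \<le> h"
    proof cases
      case 1
      with wf_streamD(1)[OF assms(1) j, of "(h, BD)"] assms(2) show ?thesis by auto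
    next
      case 2
      from expects_before[OF assms(1) wf_streamD(2)[OF assms] this]
      show ?thesis
        using wf_streamD(1)[OF assms(1) j] fst_le_next_epoch[of \<delta>] by force
    qed
  qed
qed

text \<open>The positions below \<open>n\<close> are already taken, and positions are unique, so new
  messages can only land at \<open>n\<close> or later.\<close>

lemma epoch_end_mono:
  assumes "epoch_end M s h n" "M \<subseteq> M'" "wf_stream M' s"
    "\<And>k \<delta>. Msg k s \<delta> \<in> M' - M \<Longrightarrow> h < fst \<delta>"
  shows "epoch_end M' s h n"
  unfolding epoch_end_def
proof (intro conjI allI impI)
  show "\<exists>\<delta>. Msg k s \<delta> \<in> M'" if "k < n" for k
    using that assms(1,2) by (force simp: epoch_end_def)
  fix k \<delta> assume k: "Msg k s \<delta> \<in> M'"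
  show "fst \<delta> \<le> h \<longleftrightarrow> k < n"
  proof (cases "Msg k s \<delta> \<in> M")
    case True
    with assms(1) show ?thesis by (auto simp: epoch_end_def)
  next
    case False
    have "\<not> k < n"
    proof
      assume "k < n"
      then obtain \<delta>' where "Msg k s \<delta>' \<in> M"
        using assms(1) by (auto simp: epoch_end_def)
      with wf_streamD(1)[OF assms(3) k, of \<delta>'] assms(2) False show False by auto
    qed
    with assms(4)[of k \<delta>] k False show ?thesis by auto
  qed
qed

lemma epoch_end_card:
  assumes "wf_stream M s" "epoch_end M s h n"
  shows "finite {m \<in> M. strm m = s \<and> epoch_of m \<le> h}"
    and "card {m \<in> M. strm m = s \<and> epoch_of m \<le> h} = n"
proof -
  let ?A = "{m \<in> M. strm m = s \<and> epoch_of m \<le> h}"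
  have "bij_betw seqno ?A {..<n}"
    unfolding bij_betw_def
  proof
    show "inj_on seqno ?A"
    proof (rule inj_onI)
      fix m m' assume "m \<in> ?A" "m' \<in> ?A" "seqno m = seqno m'"
      then show "m = m'"
        using assms(1) by (cases m; cases m') (auto simp: wf_stream_def)
    qed
    show "seqno ` ?A = {..<n}"
    proof
      show "seqno ` ?A \<subseteq> {..<n}"
      proof
        fix k assume "k \<in> seqno ` ?A"
        then obtain m where "m \<in> ?A" "k = seqno m" by auto
        with assms(2) show "k \<in> {..<n}"
          by (cases m) (auto simp: epoch_end_def)
      qed
      show "{..<n} \<subseteq> seqno ` ?A"
      proof
        fix k assume "k \<in> {..<n}"
        with assms(2) obtain \<delta> where "Msg k s \<delta> \<in> M" "fst \<delta> \<le> h"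
          by (auto simp: epoch_end_def)
        then show "k \<in> seqno ` ?A"
          by (intro image_eqI[of _ _ "Msg k s \<delta>"]) auto
      qed
    qed
  qed
  from bij_betw_finite[OF this] bij_betw_same_card[OF this] show "finite ?A" "card ?A = n"
    by auto
qed

text \<open>\<open>t\<close> is the output stream of the processor. The expected epoch
  \<open>E\<close> is a function because within a border step some streams are already past their
  border and others are not; between steps it is constant. The last clause keeps the position of the
  next production free.\<close>

definition proc_streams :: "'s \<Rightarrow> ('s \<rightharpoonup> nat) \<Rightarrow> ('s, 'w) msg set \<Rightarrow> ('s \<Rightarrow> nat) \<Rightarrow> bool" where
  "proc_streams t N M E \<longleftrightarrow>
     (\<forall>s. wf_stream M s) \<and> (\<forall>s n. N s = Some n \<longrightarrow> expects M s n (E s)) \<and>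
     (\<forall>n k \<delta>. N t = Some n \<longrightarrow> Msg k t \<delta> \<in> M \<longrightarrow> k < n)"

text \<open>A production fills a free position with a body of the epoch expected there; a
  consumption moves a counter past a message that is present.\<close>

lemma proc_streams_action:
  assumes invar: "proc_streams t N M E"
    and x: "x = Produce t \<delta> \<and> s = t \<or> x = Consume s \<delta> \<and> s \<noteq> t" "fst \<delta> = E s"
    and app: "apply_action x (N, M) = Some (N', M')"
  shows "\<exists>n. N s = Some n \<and> N' = N(s \<mapsto> Suc n) \<and> M \<subseteq> M' \<and> Msg n s \<delta> \<in> M' \<and>
    proc_streams t N' M' (E(s := next_epoch \<delta>))"
proof -
  from x(1) show ?thesis
  proof (elim disjE conjE)
    assume "x = Produce t \<delta>" "s = t"
    with app obtain n where n: "N s = Some n" "N' = N(s \<mapsto> Suc n)" "M' = insert (Msg n s \<delta>) M"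
      by (auto split: option.splits)
    have fresh: "Msg k s \<delta>' \<in> M \<Longrightarrow> k < n" for k \<delta>'
      using invar n(1) \<open>s = t\<close> by (auto simp: proc_streams_def)
    have exp: "expects M s n (fst \<delta>)"
      using invar n(1) x(2) by (auto simp: proc_streams_def)
    have "wf_stream M' s'" for s'
    proof -
      have wf: "wf_stream M s'" using invar by (auto simp: proc_streams_def)
      have "expects M s' k (fst \<delta>')" if "Msg k s' \<delta>' \<in> M'" for k \<delta>'
        using that n(3) exp wf_streamD(2)[OF wf] by blast
      moreover have "M \<subseteq> M'" using n(3) by auto
      moreover have "\<delta>1 = \<delta>2" if "Msg k s' \<delta>1 \<in> M'" "Msg k s' \<delta>2 \<in> M'" for k \<delta>1 \<delta>2
        using that n(3) fresh wf_streamD(1)[OF wf] by blast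
      ultimately show ?thesis
        unfolding wf_stream_def by (blast intro: expects_mono)
    qed
    moreover have "expects M' s (Suc n) (next_epoch \<delta>)"
      using n(3) by (auto simp: expects_def)
    moreover have "k < Suc n" if "Msg k s \<delta>' \<in> M'" for k \<delta>'
      using that fresh[of k \<delta>'] n(3) by auto
    moreover have "expects M' s' k (E s')" if "N s' = Some k" for s' k
      using invar that n(3) expects_mono[of M s' k "E s'" M'] by (auto simp: proc_streams_def)
    ultimately have "proc_streams t N' M' (E(s := next_epoch \<delta>))"
      using n(2) \<open>s = t\<close> by (auto simp: proc_streams_def)
    with n show ?thesis by auto
  next
    assume "x = Consume s \<delta>" "s \<noteq> t"
    with app obtain n where n: "N s = Some n" "N' = N(s \<mapsto> Suc n)" "M' = M" "Msg n s \<delta> \<in> M"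
      by (auto split: option.splits if_splits)
    moreover have "expects M s (Suc n) (next_epoch \<delta>)"
      using n(4) by (auto simp: expects_def)
    ultimately have "proc_streams t N' M' (E(s := next_epoch \<delta>))"
      using invar \<open>s \<noteq> t\<close> unfolding proc_streams_def by auto
    with n show ?thesis by auto
  qed
qed

section \<open>Streams of a processor across event and border steps\<close>

lemma proc_streams_produce_events:
  assumes "proc_streams t N M (\<lambda>_. e)"
    "apply_actions (map (\<lambda>w. Produce t (e, EV w)) W) (N, M) = Some (N', M')"
  shows "proc_streams t N' M' (\<lambda>_. e)"
  using assms
proof (induction W arbitrary: N M)
  case (Cons w W)
  then obtain N1 M1 where 1: "apply_action (Produce t (e, EV w)) (N, M) = Some (N1, M1)"
    "apply_actions (map (\<lambda>w. Produce t (e, EV w)) W) (N1, M1) = Some (N', M')"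
    by (auto simp: bind_eq_Some_conv simp del: apply_action.simps)
  have "proc_streams t N1 M1 (\<lambda>_. e)"
    using proc_streams_action[OF Cons.prems(1) _ _ 1(1), of "(e, EV w)" t]
    by (auto simp: fun_upd_idem)
  from Cons.IH[OF this 1(2)] show ?case .
qed simp

lemma proc_streams_event:
  assumes "proc_streams t N M (\<lambda>_. e)" "s \<noteq> t"
    "apply_actions (Consume s (e, EV w) # map (\<lambda>w. Produce t (e, EV w)) W) (N, M) = Some (N', M')"
  shows "proc_streams t N' M' (\<lambda>_. e)"
proof -
  from assms(3) obtain N1 M1 where 1: "apply_action (Consume s (e, EV w)) (N, M) = Some (N1, M1)"
    "apply_actions (map (\<lambda>w. Produce t (e, EV w)) W) (N1, M1) = Some (N', M')"
    by (auto simp: bind_eq_Some_conv simp del: apply_action.simps)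
  have "proc_streams t N1 M1 (\<lambda>_. e)"
    using proc_streams_action[OF assms(1) _ _ 1(1), of "(e, EV w)" s] assms(2)
    by (auto simp: fun_upd_idem)
  from proc_streams_produce_events[OF this 1(2)] show ?thesis .
qed

text \<open>\<open>A\<close> collects the streams whose border has been consumed. Distinctness of
  \<open>S\<close> ensures that each stream still expects \<open>e\<close> when its turn
  comes.\<close>

lemma proc_streams_consume_borders:
  assumes "proc_streams t N M (\<lambda>s. if s \<in> A then Suc e else e)" "t \<notin> set S" "distinct S"
    "set S \<inter> A = {}" "apply_actions (map (\<lambda>s. Consume s (e, BD)) S) (N, M) = Some (N', M')"
  shows "proc_streams t N' M' (\<lambda>s. if s \<in> A \<union> set S then Suc e else e) \<and> M \<subseteq> M' \<and>
    (\<forall>s \<in> set S. \<exists>n. N' s = Some (Suc n) \<and> Msg n s (e, BD) \<in> M') \<and>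
    (\<forall>s. s \<notin> set S \<longrightarrow> N' s = N s)"
  using assms
proof (induction S arbitrary: N M A)
  case (Cons s S)
  from Cons.prems(5) obtain N1 M1 where 1: "apply_action (Consume s (e, BD)) (N, M) = Some (N1, M1)"
    "apply_actions (map (\<lambda>s. Consume s (e, BD)) S) (N1, M1) = Some (N', M')"
    by (auto simp: bind_eq_Some_conv simp del: apply_action.simps)
  have "e = (if s \<in> A then Suc e else e)" "s \<noteq> t"
    using Cons.prems(2,4) by auto
  then obtain n where n: "N1 = N(s \<mapsto> Suc n)" "M \<subseteq> M1" "Msg n s (e, BD) \<in> M1"
    "proc_streams t N1 M1 ((\<lambda>s. if s \<in> A then Suc e else e)(s := Suc e))"
    using proc_streams_action[OF Cons.prems(1) disjI2[OF conjI[OF refl]] _ 1(1), unfolded fst_conv next_epoch_simps] by blast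
  have "(\<lambda>s. if s \<in> A then Suc e else e)(s := Suc e) =
      (\<lambda>s'. if s' \<in> insert s A then Suc e else e)"
    by auto
  with n(4) have "proc_streams t N1 M1 (\<lambda>s'. if s' \<in> insert s A then Suc e else e)"
    by simp
  from Cons.IH[OF this _ _ _ 1(2)] Cons.prems n show ?case
    by auto
qed simp

text \<open>After the final production all streams of the processor expect \<open>Suc e\<close>. The
  second fact puts every counter right behind a border of epoch \<open>e\<close>, ready for
  \<open>epoch_end_border\<close>.\<close>

lemma proc_streams_border:
  assumes "proc_streams t N M (\<lambda>_. e)" "t \<notin> set S" "distinct S" "dom N = insert t (set S)"
    "apply_actions (map (\<lambda>s. Consume s (e, BD)) S @ [Produce t (e, BD)]) (N, M) = Some (N', M')"
  shows "proc_streams t N' M' (\<lambda>_. Suc e)"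
    "\<And>s n. N' s = Some n \<Longrightarrow> \<exists>k. n = Suc k \<and> Msg k s (e, BD) \<in> M'"
proof -
  from assms(5) obtain N1 M1 where 1: "apply_actions (map (\<lambda>s. Consume s (e, BD)) S) (N, M) = Some (N1, M1)"
    "apply_action (Produce t (e, BD)) (N1, M1) = Some (N', M')"
    by (auto simp: apply_actions_append bind_eq_Some_conv simp del: apply_action.simps)
  have 2: "proc_streams t N1 M1 (\<lambda>s. if s \<in> set S then Suc e else e)"
    "\<forall>s \<in> set S. \<exists>n. N1 s = Some (Suc n) \<and> Msg n s (e, BD) \<in> M1"
    "\<forall>s. s \<notin> set S \<longrightarrow> N1 s = N s"
    using proc_streams_consume_borders[of t N M "{}" e S N1 M1] assms 1(1) by auto
  have "e = (if t \<in> set S then Suc e else e)"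
    using assms(2) by auto
  then obtain n where n: "N' = N1(t \<mapsto> Suc n)" "M1 \<subseteq> M'" "Msg n t (e, BD) \<in> M'"
    "proc_streams t N' M' ((\<lambda>s. if s \<in> set S then Suc e else e)(t := Suc e))"
    using proc_streams_action[OF 2(1) disjI1[OF conjI[OF refl refl]] _ 1(2), unfolded fst_conv next_epoch_simps] by blast
  have dom: "dom N' = insert t (set S)"
    using apply_actions_dom[OF assms(5)] assms(4) by simp
  then show "proc_streams t N' M' (\<lambda>_. Suc e)"
    using n(4) unfolding proc_streams_def
    by (auto split: if_splits) (metis domI insertE)+
  show "\<exists>k. m = Suc k \<and> Msg k s (e, BD) \<in> M'" if "N' s = Some m" for s m
  proof (cases "s = t")
    case True
    with that n show ?thesis by auto
  next
    case False
    then have "s \<in> set S" using dom that by auto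
    with 2(2) obtain k where "N1 s = Some (Suc k)" "Msg k s (e, BD) \<in> M1" by auto
    with False that n(1,2) show ?thesis by auto
  qed
qed


section \<open>Invariant of failure-free configurations\<close>

text \<open>With the archive exactly \<open>{..<e}\<close>, a processor has a snapshot of every
  epoch before its current one, in particular of the greatest common epoch.\<close>

definition invar :: "('s, 'v, 'w) config \<Rightarrow> bool" where
  "invar c \<longleftrightarrow> wf_config c \<and>
     (\<forall>p < length (procs c). \<forall>q < length (procs c).
        outs (procs c ! p) = outs (procs c ! q) \<longrightarrow> p = q) \<and>
     (\<forall>\<pi> \<in> set (procs c). distinct (ins \<pi>) \<and> outs \<pi> \<notin> set (ins \<pi>)) \<and>
     init_msgs c \<subseteq> msgs c \<and>
     (\<forall>p < length (procs c). \<exists>a e v. states c ! p = (a, Normal e v) \<and> fmdom' a = {..<e} \<and>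
        0 < e \<and> proc_streams (outs (procs c ! p)) (nums c ! p) (msgs c) (\<lambda>_. e))"

lemma invarE:
  assumes "invar c" "p < length (procs c)"
  obtains a e v where "states c ! p = (a, Normal e v)" "fmdom' a = {..<e}" "0 < e"
    "proc_streams (outs (procs c ! p)) (nums c ! p) (msgs c) (\<lambda>_. e)"
  using assms unfolding invar_def by blast

lemma invar_wf_config: "invar c \<Longrightarrow> wf_config c"
  by (simp add: invar_def)

lemma invar_lengths:
  assumes "invar c"
  shows "length (states c) = length (procs c)" "length (nums c) = length (procs c)" "procs c \<noteq> []"
  using invar_wf_config[OF assms] by (auto simp: wf_config_def)

lemma invar_init_msgs: "invar c \<Longrightarrow> init_msgs c \<subseteq> msgs c"
  by (simp add: invar_def)

lemma invar_wf_stream: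
  assumes "invar c"
  shows "wf_stream (msgs c) s"
  using invarE[OF assms, of 0] invar_lengths[OF assms] unfolding proc_streams_def by blast

lemma invar_dom_nums:
  assumes "invar c" "p < length (procs c)"
  shows "dom (nums c ! p) = insert (outs (procs c ! p)) (set (ins (procs c ! p)))"
  using invar_wf_config[OF assms(1)] assms(2) by (auto simp: wf_config_def)

lemma pstep_normalE:
  assumes "invar c" "pstep normal_rules p X \<sigma>' c c'"
  obtains a e v N' \<Delta> where "p < length (procs c)" "states c ! p = (a, Normal e v)"
    "apply_actions X (nums c ! p, msgs c) = Some (N', msgs c \<union> \<Delta>)"
    "c' = Config (procs c) ((states c)[p := \<sigma>']) ((nums c)[p := N']) (msgs c \<union> \<Delta>) (init_msgs c)"
    "dom N' = dom (nums c ! p)"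
    "\<And>m. m \<in> \<Delta> \<Longrightarrow> epoch_of m = e \<and> strm m = outs (procs c ! p)"
    "(\<exists>v'. \<sigma>' = (a, Normal e v')) \<and>
        proc_streams (outs (procs c ! p)) N' (msgs c \<union> \<Delta>) (\<lambda>_. e) \<or>
      \<sigma>' = (fmupd e v a, Normal (Suc e) v) \<and>
        proc_streams (outs (procs c ! p)) N' (msgs c \<union> \<Delta>) (\<lambda>_. Suc e) \<and>
        (\<forall>s n. N' s = Some n \<longrightarrow> (\<exists>k. n = Suc k \<and> Msg k s (e, BD) \<in> msgs c \<union> \<Delta>))"
proof -
  let ?\<pi> = "procs c ! p"
  from assms(2) obtain N' M' where p: "p < length (procs c)"
    and loc: "local_step normal_rules ?\<pi> (states c ! p) X \<sigma>'"
    and app: "apply_actions X (nums c ! p, msgs c) = Some (N', M')"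
    and c': "c' = Config (procs c) ((states c)[p := \<sigma>']) ((nums c)[p := N']) M' (init_msgs c)"
    by (auto simp: pstep_def)
  obtain a e v where st: "states c ! p = (a, Normal e v)"
    and ps: "proc_streams (outs ?\<pi>) (nums c ! p) (msgs c) (\<lambda>_. e)"
    using invarE[OF assms(1) p] by metis
  obtain \<Delta> where D: "M' = msgs c \<union> \<Delta>"
    "\<And>m. m \<in> \<Delta> \<Longrightarrow> Produce (strm m) (body m) \<in> set X"
    by (rule apply_actions_frame[OF app]) blast
  have io: "distinct (ins ?\<pi>)" "outs ?\<pi> \<notin> set (ins ?\<pi>)"
    using assms(1) p by (auto simp: invar_def)
  have new: "epoch_of m = e \<and> strm m = outs ?\<pi>" if "m \<in> \<Delta>" for m
    using D(2)[OF that] local_step_normal[OF loc[unfolded st]] by fastforce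
  from loc have "(\<exists>v'. \<sigma>' = (a, Normal e v')) \<and> proc_streams (outs ?\<pi>) N' M' (\<lambda>_. e) \<or>
      \<sigma>' = (fmupd e v a, Normal (Suc e) v) \<and> proc_streams (outs ?\<pi>) N' M' (\<lambda>_. Suc e) \<and>
        (\<forall>s n. N' s = Some n \<longrightarrow> (\<exists>k. n = Suc k \<and> Msg k s (e, BD) \<in> M'))"
  proof (cases rule: local_step_normal_cases)
    case (event a' e' v0 v' w W' s)
    with st have "\<sigma>' = (a, Normal e v')" and
      X: "X = Consume s (e, EV w) # map (\<lambda>w'. Produce (outs ?\<pi>) (e, EV w')) W'"
      by auto
    moreover have "proc_streams (outs ?\<pi>) N' M' (\<lambda>_. e)"
      by (rule proc_streams_event[OF ps _ app[unfolded X]]) (use event(3) io in auto)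
    ultimately show ?thesis by auto
  next
    case (border a' e' v0)
    with st have \<sigma>': "\<sigma>' = (fmupd e v a, Normal (Suc e) v)" and
      X: "X = map (\<lambda>s. Consume s (e, BD)) (ins ?\<pi>) @ [Produce (outs ?\<pi>) (e, BD)]"
      by auto
    from proc_streams_border[OF ps io(2,1) invar_dom_nums[OF assms(1) p] app[unfolded X]] \<sigma>'
    show ?thesis by blast
  qed
  with p st app c' new apply_actions_dom[OF app] D(1) show ?thesis
    by (intro that[of a e v N' \<Delta>]) auto
qed

text \<open>For the other processors only the message set changes: it grows, so their expectations
  persist, and their output streams receive nothing, as every stream has one producer.\<close>

lemma invar_pstep:
  assumes "invar c" "pstep normal_rules p X \<sigma>' c c'"
  shows "invar c'"
  using assms
proof (cases rule: pstep_normalE)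
  case (1 a e v N' \<Delta>)
  let ?M = "msgs c \<union> \<Delta>"
  note len = invar_lengths[OF assms(1)]
  have wf: "wf_stream ?M s" for s
    using 1(7) by (auto simp: proc_streams_def)
  have sel: "procs c' = procs c" "msgs c' = ?M" "init_msgs c' = init_msgs c"
    using 1(4) by auto
  have "\<exists>a e v. states c' ! q = (a, Normal e v) \<and> fmdom' a = {..<e} \<and>
        0 < e \<and> proc_streams (outs (procs c ! q)) (nums c' ! q) ?M (\<lambda>_. e)"
    if q: "q < length (procs c)" for q
  proof (cases "q = p")
    case True
    then have "states c' ! q = \<sigma>'" "nums c' ! q = N'"
      using 1(1,4) len by auto
    moreover have "fmdom' a = {..<e}" "0 < e"
      using invarE[OF assms(1) 1(1)] 1(2) by auto
    moreover from this have "fmdom' (fmupd e v a) = {..<Suc e}"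
      by (simp add: lessThan_Suc)
    ultimately show ?thesis
      using 1(7) True by auto
  next
    case False
    obtain b e' v' where q': "states c ! q = (b, Normal e' v')" "fmdom' b = {..<e'}" "0 < e'"
      "proc_streams (outs (procs c ! q)) (nums c ! q) (msgs c) (\<lambda>_. e')"
      using invarE[OF assms(1) q] by blast
    have "outs (procs c ! q) \<noteq> outs (procs c ! p)"
      using assms(1) q 1(1) False unfolding invar_def by blast
    with 1(6) have "Msg k (outs (procs c ! q)) \<delta> \<notin> \<Delta>" for k \<delta>
      by fastforce
    with q'(4) wf have "proc_streams (outs (procs c ! q)) (nums c ! q) ?M (\<lambda>_. e')"
      unfolding proc_streams_def by (auto intro: expects_mono[of "msgs c"])
    with q' False show ?thesis
      using 1(4) by auto
  qed
  moreover have "wf_config c'"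
    using invar_wf_config[OF assms(1)] 1(1,4,5)
    by (auto simp: wf_config_def nth_list_update)
  ultimately show ?thesis
    using assms(1) unfolding invar_def sel by auto
qed

lemma invar_run:
  assumes "invar c" "run_by A c c'"
  shows "invar c'"
  using assms(2,1) unfolding run_by_def
  by (induction rule: rtranclp_induct) (auto intro: invar_pstep)

text \<open>A reader cannot overtake the writer: the last message before its counter lies before the
  writer's counter too, and epochs do not decrease along the stream.\<close>

lemma consumer_epoch_le:
  assumes "invar c" "p < length (procs c)" "q < length (procs c)"
    "states c ! p = (a, Normal e v)" "states c ! q = (a', Normal e' v')"
    "outs (procs c ! p) \<in> dom (nums c ! q)"
  shows "e' \<le> e"
proof -
  let ?s = "outs (procs c ! p)"
  note wf = invar_wf_stream[OF assms(1), of ?s]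
  have p: "0 < e" "proc_streams ?s (nums c ! p) (msgs c) (\<lambda>_. e)"
    using invarE[OF assms(1,2)] assms(4) by auto
  have q: "proc_streams (outs (procs c ! q)) (nums c ! q) (msgs c) (\<lambda>_. e')"
    using invarE[OF assms(1,3)] assms(5) by auto
  obtain n where "(nums c ! q) ?s = Some n"
    using assms(6) by auto
  with q have exp: "expects (msgs c) ?s n e'"
    by (auto simp: proc_streams_def)
  show ?thesis
  proof (cases n)
    case 0
    with exp p(1) show ?thesis by (simp add: expects_def)
  next
    case (Suc k)
    with exp obtain \<delta> where \<delta>: "Msg k ?s \<delta> \<in> msgs c" "next_epoch \<delta> = e'"
      by (auto simp: expects_def)
    obtain n' where "(nums c ! p) ?s = Some n'"
      using invar_dom_nums[OF assms(1,2)] by blast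
    with p(2) \<delta>(1) have "k < n'" "expects (msgs c) ?s n' e"
      unfolding proc_streams_def by blast+
    from expects_before[OF wf this(2,1)] show ?thesis
      using wf_streamD(1)[OF wf \<delta>(1)] \<delta>(2) by auto
  qed
qed


section \<open>Cutting a configuration at an epoch\<close>

text \<open>In \<open>x\<close>, every processor of \<open>c\<close> that is past epoch \<open>h\<close> has been put back to the end of
  epoch \<open>h\<close>.\<close>

definition cut_at :: "nat \<Rightarrow> ('s, 'v, 'w) config \<Rightarrow> ('s, 'v, 'w) config \<Rightarrow> bool" where
  "cut_at h c x \<longleftrightarrow>
     procs x = procs c \<and> init_msgs x = init_msgs c \<and>
     length (states x) = length (states c) \<and> length (nums x) = length (nums c) \<and>
     msgs x = {m \<in> msgs c. m \<in> init_msgs c \<or> epoch_of m \<le> h} \<and>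
     (\<forall>p < length (procs c). \<forall>a e v. states c ! p = (a, Normal e v) \<longrightarrow>
        (if e \<le> h then states x ! p = states c ! p \<and> nums x ! p = nums c ! p
         else states x ! p = (fmfilter (\<lambda>e. e \<le> h) a, Normal (h + 1) (the (fmlookup a h))) \<and>
           dom (nums x ! p) = dom (nums c ! p) \<and>
           (\<forall>s n. (nums x ! p) s = Some n \<longrightarrow> epoch_end (msgs c) s h n)))"

definition past :: "nat \<Rightarrow> ('s, 'v, 'w) config \<Rightarrow> nat set" where
  "past h c = {p. p < length (procs c) \<and> (\<exists>a e v. states c ! p = (a, Normal e v) \<and> h < e)}"

text \<open>The step writes only messages of an epoch beyond \<open>h\<close>, which the cut drops
  again, and at most an archive entry beyond \<open>h\<close>.\<close>

lemma cut_at_step_past: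
  assumes "invar c" "cut_at h c x" "pstep normal_rules p X \<sigma>' c c'" "p \<in> past h c"
  shows "cut_at h c' x"
  using assms(1,3)
proof (cases rule: pstep_normalE)
  case (1 a e v N' \<Delta>)
  have e: "h < e" using assms(4) 1(2) by (auto simp: past_def)
  note len = invar_lengths[OF assms(1)]
  have sel: "procs c' = procs c" "msgs c' = msgs c \<union> \<Delta>" "init_msgs c' = init_msgs c"
    using 1(4) by auto
  have ee: "epoch_end (msgs c \<union> \<Delta>) s h n" if "epoch_end (msgs c) s h n" for s n
    by (rule epoch_end_mono[OF that])
      (use invar_wf_stream[OF invar_pstep[OF assms(1,3)], of s] sel 1(6) e in \<open>force+\<close>)
  have "{m \<in> msgs c. m \<in> init_msgs c \<or> epoch_of m \<le> h} =
      {m \<in> msgs c \<union> \<Delta>. m \<in> init_msgs c \<or> epoch_of m \<le> h}"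
    using 1(6) e invar_init_msgs[OF assms(1)] by fastforce
  moreover have "if e' \<le> h then states x ! q = states c' ! q \<and> nums x ! q = nums c' ! q
         else states x ! q = (fmfilter (\<lambda>e. e \<le> h) b, Normal (h + 1) (the (fmlookup b h))) \<and>
           dom (nums x ! q) = dom (nums c' ! q) \<and>
           (\<forall>s n. (nums x ! q) s = Some n \<longrightarrow> epoch_end (msgs c \<union> \<Delta>) s h n)"
    if q: "q < length (procs c)" "states c' ! q = (b, Normal e' v')" for q b e' v'
  proof (cases "q = p")
    case False
    then have "states c ! q = (b, Normal e' v')" "states c' ! q = states c ! q"
      "nums c' ! q = nums c ! q"
      using 1(4) q by auto
    with assms(2) q(1) ee show ?thesis
      by (auto simp: cut_at_def)
  next
    case True
    then have q': "states c' ! q = \<sigma>'" "nums c' ! q = N'"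
      using 1(1,4) len by auto
    have "h < e' \<and> fmfilter (\<lambda>e. e \<le> h) b = fmfilter (\<lambda>e. e \<le> h) a \<and> fmlookup b h = fmlookup a h"
      using q(2) q'(1) 1(7) e by (auto simp: fmfilter_upd)
    moreover have "states x ! p = (fmfilter (\<lambda>e. e \<le> h) a, Normal (h + 1) (the (fmlookup a h)))"
      "dom (nums x ! p) = dom (nums c ! p)"
      "\<forall>s n. (nums x ! p) s = Some n \<longrightarrow> epoch_end (msgs c) s h n"
      using assms(2) 1(1,2) e by (auto simp: cut_at_def)
    ultimately show ?thesis
      using True q' 1(5) ee by auto
  qed
  moreover have "procs x = procs c" "init_msgs x = init_msgs c"
    "length (states x) = length (states c')" "length (nums x) = length (nums c')"
    "msgs x = {m \<in> msgs c. m \<in> init_msgs c \<or> epoch_of m \<le> h}"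
    using assms(2) 1(4) by (auto simp: cut_at_def)
  ultimately show ?thesis
    unfolding cut_at_def sel by blast
qed

text \<open>The step reads only messages of an epoch up to \<open>h\<close>, which survive the cut,
  so it can be replayed in \<open>x\<close>. It remains to see that it does not disturb processors
  past \<open>h\<close> and that a processor which crosses \<open>h\<close> by this step arrives
  exactly in its cut state.\<close>

lemma cut_at_step:
  assumes "invar c" "cut_at h c x" "pstep normal_rules p X \<sigma>' c c'" "p \<notin> past h c"
  shows "\<exists>x'. pstep normal_rules p X \<sigma>' x x' \<and> cut_at h c' x'"
  using assms(1,3)
proof (cases rule: pstep_normalE)
  case (1 a e v N' \<Delta>)
  have e: "e \<le> h" using assms(4) 1(1,2) by (auto simp: past_def)
  note len = invar_lengths[OF assms(1)]
  have wf': "wf_stream (msgs c \<union> \<Delta>) s" for s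
    using invar_wf_stream[OF invar_pstep[OF assms(1,3)], of s] 1(4) by simp
  have x: "procs x = procs c" "init_msgs x = init_msgs c" "length (states x) = length (procs c)"
    "length (nums x) = length (procs c)" "states x ! p = states c ! p" "nums x ! p = nums c ! p"
    "msgs x = {m \<in> msgs c. m \<in> init_msgs c \<or> epoch_of m \<le> h}"
    using assms(2) 1(1,2) e len by (auto simp: cut_at_def)
  have loc: "local_step normal_rules (procs c ! p) (states c ! p) X \<sigma>'"
    using assms(3) by (auto simp: pstep_def)
  have ep: "fst \<delta> = e" if "\<delta> \<in> action_body ` set X" for \<delta>
    using local_step_normal(1)[OF loc[unfolded 1(2)]] that by auto
  have app: "apply_actions X (nums x ! p, msgs x) = Some (N', msgs x \<union> \<Delta>)"
  proof -
    obtain \<Delta>' where D: "msgs c \<union> \<Delta> = msgs c \<union> \<Delta>'"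
      "\<And>M2. {m \<in> msgs c. body m \<in> action_body ` set X} \<subseteq> M2 \<Longrightarrow>
         apply_actions X (nums c ! p, M2) = Some (N', M2 \<union> \<Delta>')"
      "\<And>m. m \<in> \<Delta>' \<Longrightarrow> Produce (strm m) (body m) \<in> set X"
      by (rule apply_actions_frame[OF 1(3)]) blast
    have "epoch_of m = e" if "m \<in> \<Delta>'" for m
      using ep[of "body m"] D(3)[OF that] by force
    \<comment> \<open>The two sets can differ only in messages that \<open>msgs c\<close> already
      contains; these have epoch \<open>e \<le> h\<close> and are therefore in
      \<open>msgs x\<close>.\<close>
    then have "msgs x \<union> \<Delta>' = msgs x \<union> \<Delta>"
      using D(1) 1(6) e unfolding x(7) by fastforce
    moreover have "{m \<in> msgs c. body m \<in> action_body ` set X} \<subseteq> msgs x"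
      using ep e x(7) by fastforce
    ultimately show ?thesis
      using D(2)[of "msgs x"] x(6) by simp
  qed
  define x' where "x' = Config (procs x) ((states x)[p := \<sigma>']) ((nums x)[p := N'])
    (msgs x \<union> \<Delta>) (init_msgs x)"
  with app loc x 1(1) have step: "pstep normal_rules p X \<sigma>' x x'"
    by (auto simp: pstep_def)
  have sel: "procs c' = procs c" "msgs c' = msgs c \<union> \<Delta>" "init_msgs c' = init_msgs c"
    using 1(4) by auto
  have "msgs x' = {m \<in> msgs c \<union> \<Delta>. m \<in> init_msgs c \<or> epoch_of m \<le> h}"
    unfolding x'_def using x(7) 1(6) e by auto
  moreover have "if e' \<le> h then states x' ! q = states c' ! q \<and> nums x' ! q = nums c' ! q
         else states x' ! q = (fmfilter (\<lambda>e. e \<le> h) b, Normal (h + 1) (the (fmlookup b h))) \<and>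
           dom (nums x' ! q) = dom (nums c' ! q) \<and>
           (\<forall>s n. (nums x' ! q) s = Some n \<longrightarrow> epoch_end (msgs c \<union> \<Delta>) s h n)"
    if q: "q < length (procs c)" "states c' ! q = (b, Normal e' v')" for q b e' v'
  proof (cases "q = p")
    case False
    then have q': "states c ! q = (b, Normal e' v')" "states c' ! q = states c ! q"
      "nums c' ! q = nums c ! q" "states x' ! q = states x ! q" "nums x' ! q = nums x ! q"
      using 1(4) q by (auto simp: x'_def)
    have old: "if e' \<le> h then states x ! q = states c ! q \<and> nums x ! q = nums c ! q
         else states x ! q = (fmfilter (\<lambda>e. e \<le> h) b, Normal (h + 1) (the (fmlookup b h))) \<and>
           dom (nums x ! q) = dom (nums c ! q) \<and>
           (\<forall>s n. (nums x ! q) s = Some n \<longrightarrow> epoch_end (msgs c) s h n)"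
      using assms(2) q(1) q'(1) by (auto simp: cut_at_def)
    have "epoch_end (msgs c \<union> \<Delta>) s h n" if "\<not> e' \<le> h" "(nums x ! q) s = Some n" for s n
    proof (rule epoch_end_mono)
      show "epoch_end (msgs c) s h n" using old that by auto
      \<comment> \<open>There is no such message: it would be a new output of \<open>p\<close> on a
        stream of \<open>q\<close>, so \<open>q\<close> could not be ahead of \<open>p\<close>,
        contrary to \<open>e \<le> h < e'\<close>.\<close>
      fix k \<delta> assume "Msg k s \<delta> \<in> msgs c \<union> \<Delta> - msgs c"
      then have "s = outs (procs c ! p)" using 1(6) by fastforce
      moreover have "s \<in> dom (nums c ! q)" using old that by auto
      ultimately have "e' \<le> e"
        using consumer_epoch_le[OF assms(1) 1(1) q(1) 1(2) q'(1)] by simp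
      with e that show "h < fst \<delta>" by simp
    qed (use wf' in auto)
    with old q' show ?thesis by auto
  next
    case True
    then have q': "states c' ! q = \<sigma>'" "nums c' ! q = N'" "states x' ! q = \<sigma>'" "nums x' ! q = N'"
      using 1(1,4) len x(3,4) by (auto simp: x'_def)
    show ?thesis
    proof (cases "e' \<le> h")
      case True
      with q' show ?thesis by simp
    next
      case False
      \<comment> \<open>Only a border step raises the epoch, and only by one. So \<open>p\<close>
        has just completed epoch \<open>h\<close>, and its newest archive entry is the one at
        \<open>h\<close>.\<close>
      with 1(7) q(2) q'(1) e have h: "e = h" by auto
      with False 1(7) q(2) q'(1) have *: "e' = Suc h" "b = fmupd h v a" "v' = v"
        "\<And>s n. N' s = Some n \<Longrightarrow> \<exists>k. n = Suc k \<and> Msg k s (h, BD) \<in> msgs c \<union> \<Delta>"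
        by auto
      have "fmdom' a = {..<h}"
        using invarE[OF assms(1) 1(1)] 1(2) h by auto
      then have "fmfilter (\<lambda>e. e \<le> h) a = a"
        using fmdom'I[of a] by (intro fmfilter_true) force
      then have "fmfilter (\<lambda>e. e \<le> h) b = b"
        unfolding *(2) by (simp add: fmfilter_upd)
      moreover have "epoch_end (msgs c \<union> \<Delta>) s h n" if "N' s = Some n" for s n
        using *(4)[OF that] epoch_end_border[OF wf'] by auto
      ultimately show ?thesis
        using False q' q(2) * by auto
    qed
  qed
  moreover have "procs x' = procs c" "init_msgs x' = init_msgs c"
    "length (states x') = length (states c')" "length (nums x') = length (nums c')"
    using x(1-4) len 1(4) by (auto simp: x'_def)
  ultimately have "cut_at h c' x'"
    unfolding cut_at_def sel by blast
  with step show ?thesis by blast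
qed

lemma past_mono:
  assumes "invar c" "pstep normal_rules p X \<sigma>' c c'"
  shows "past h c \<subseteq> past h c'"
  using assms
proof (cases rule: pstep_normalE)
  case (1 a e v N' \<Delta>)
  show ?thesis
  proof
    fix q assume "q \<in> past h c"
    then show "q \<in> past h c'"
      using 1 invar_lengths[OF assms(1)] by (cases "q = p") (auto simp: past_def)
  qed
qed

text \<open>The work beyond epoch \<open>h\<close> can be postponed to the end of a run: a step up to epoch \<open>h\<close>
  is taken by a processor that is not past \<open>h\<close> and thus commutes with all postponed steps.\<close>

lemma postpone:
  assumes "run_by UNIV d c" "invar d" "cut_at h d d"
  shows "\<exists>x. run_by UNIV d x \<and> run_by (past h c) x c \<and> cut_at h c x"
proof -
  have "(\<lambda>c c'. \<exists>q\<in>UNIV. \<exists>Y \<tau>. pstep normal_rules q Y \<tau> c c')\<^sup>*\<^sup>* d c"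
    using assms(1) by (simp add: run_by_def)
  then show ?thesis
  proof (induction rule: rtranclp_induct)
    case base
    with assms(3) run_by_refl show ?case by blast
  next
    case (step c c')
    then have "run_by UNIV d c" by (simp add: run_by_def)
    with assms(2) have invar: "invar c" by (rule invar_run)
    from step obtain x p X \<sigma> where x: "run_by UNIV d x" "run_by (past h c) x c" "cut_at h c x"
      and p: "pstep normal_rules p X \<sigma> c c'"
      by blast
    note mono = past_mono[OF invar p, of h]
    show ?case
    proof (cases "p \<in> past h c")
      case True
      with x p mono cut_at_step_past[OF invar x(3) p] show ?thesis
        by (meson run_by_mono run_by_step subsetD)
    next
      case False
      from cut_at_step[OF invar x(3) p this] obtain x' where
        x': "pstep normal_rules p X \<sigma> x x'" "cut_at h c' x'" by blast
      from run_by_strip[OF x(2) False x'(1)] obtain c'' where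
        "pstep normal_rules p X \<sigma> c c''" "run_by (past h c) x' c''" by blast
      \<comment> \<open>Commuting yields some end point \<open>c''\<close>; the label fixes the
        result of the step, so it is \<open>c'\<close>.\<close>
      with pstep_deterministic[OF p] have "run_by (past h c) x' c'" by blast
      with mono x(1) x' show ?thesis
        by (meson run_by_mono run_by_step UNIV_I)
    qed
  qed
qed


section \<open>The latest common snapshot\<close>

lemma out_eq: "gce c = Some g \<Longrightarrow> out c = {m \<in> msgs c. epoch_of m \<le> g}"
  by (simp add: out_def)

text \<open>The largest key of the archive \<open>{..<e}\<close> is \<open>e - 1\<close>. Hence a
  cut at the greatest common epoch puts back every processor, just as \<open>lcs\<close>
  does.\<close>

lemma gce_past:
  assumes "invar c" "gce c = Some g" "p < length (procs c)"
  shows "p \<in> past g c"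
proof -
  obtain a e v where st: "states c ! p = (a, Normal e v)" "fmdom' a = {..<e}" "0 < e"
    using invarE[OF assms(1,3)] by metis
  then have "Max (fmdom' a) \<in> {..<e}"
    by (metis Max_in finite_lessThan lessThan_empty_iff not_gr0)
  moreover have "g \<le> Max (fmdom' a)"
    using gce_SomeD[OF assms(2), of p] st(1) invar_lengths[OF assms(1)] assms(3) by simp
  ultimately show ?thesis
    using st(1) assms(3) by (auto simp: past_def)
qed

text \<open>The point is the counters: \<open>cut_at\<close> places them at the end of epoch
  \<open>g\<close>, and \<open>epoch_end_card\<close> shows that this is the finite number of
  messages counted by \<open>lcs\<close>.\<close>

lemma lcs_cut_at:
  assumes "invar c" "gce c = Some g" "cut_at g c x"
  shows "lcs c = Some x"
proof -
  note len = invar_lengths[OF assms(1)]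
  have cut: "procs x = procs c" "init_msgs x = init_msgs c"
    "length (states x) = length (states c)" "length (nums x) = length (nums c)"
    "msgs x = init_msgs c \<union> out c"
    using assms(3) invar_init_msgs[OF assms(1)] by (auto simp: cut_at_def out_eq[OF assms(2)])
  have proc: "\<exists>a e v. states c ! p = (a, Normal e v) \<and> g \<in> fmdom' a \<and>
      states x ! p = (fmfilter (\<lambda>e. e \<le> g) a, Normal (g + 1) (the (fmlookup a g))) \<and>
      dom (nums x ! p) = dom (nums c ! p) \<and>
      (\<forall>s n. (nums x ! p) s = Some n \<longrightarrow> epoch_end (msgs c) s g n)"
    if p: "p < length (procs c)" for p
  proof -
    obtain a e v where "states c ! p = (a, Normal e v)" "fmdom' a = {..<e}"
      using invarE[OF assms(1) p] by metis
    moreover from this have "g < e"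
      using gce_past[OF assms(1,2) p] by (auto simp: past_def)
    ultimately show ?thesis
      using assms(3) p by (auto simp: cut_at_def)
  qed
  have stream: "on_stream (out c) s = {m \<in> msgs c. strm m = s \<and> epoch_of m \<le> g}" for s
    by (auto simp: on_stream_def out_eq[OF assms(2)])
  have num: "finite (on_stream (out c) s) \<and> card (on_stream (out c) s) = n"
    if "p < length (procs c)" "(nums x ! p) s = Some n" for p s n
    using epoch_end_card[OF invar_wf_stream[OF assms(1)], of s g n] proc[OF that(1)] that(2)
    unfolding stream by auto
  have "\<forall>(a, \<sigma>V) \<in> set (states c). g \<in> fmdom' a"
    using proc len by (fastforce simp: in_set_conv_nth)
  moreover have "\<forall>N \<in> set (nums c). \<forall>s \<in> dom N. finite (on_stream (out c) s)"
  proof (intro ballI)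
    fix N s assume "N \<in> set (nums c)" "s \<in> dom N"
    then obtain p where p: "p < length (procs c)" "s \<in> dom (nums c ! p)"
      using len by (metis in_set_conv_nth)
    then obtain n where "(nums x ! p) s = Some n"
      using proc[OF p(1)] by blast
    with num[OF p(1)] show "finite (on_stream (out c) s)" by blast
  qed
  moreover have "map (\<lambda>(a, \<sigma>V). (fmfilter (\<lambda>e. e \<le> g) a, Normal (g + 1) (the (fmlookup a g))))
      (states c) = states x"
    using cut(3) len proc by (intro nth_equalityI) fastforce+
  moreover have "map (\<lambda>N s. if s \<in> dom N then Some (card (on_stream (out c) s)) else None)
      (nums c) = nums x"
  proof (rule nth_equalityI)
    fix p assume "p < length (map (\<lambda>N s. if s \<in> dom N then Some (card (on_stream (out c) s)) else None)
      (nums c))"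
    then have p: "p < length (procs c)" using len by simp
    have "(if s \<in> dom (nums c ! p) then Some (card (on_stream (out c) s)) else None) =
        (nums x ! p) s" for s
    proof (cases "(nums x ! p) s")
      case None
      then have "s \<notin> dom (nums c ! p)" using proc[OF p] by blast
      with None show ?thesis by simp
    next
      case (Some n)
      then have "s \<in> dom (nums c ! p)" using proc[OF p] by blast
      with Some num[OF p] show ?thesis by auto
    qed
    then show "map (\<lambda>N s. if s \<in> dom N then Some (card (on_stream (out c) s)) else None)
        (nums c) ! p = nums x ! p"
      using p len by auto
  qed (use cut(4) in simp)
  ultimately show ?thesis
    using assms(2) cut(1,2,5) by (cases x) (simp add: lcs_def)
qed

text \<open>This lets the snapshot reached by one application of \<open>postpone\<close> be the
  start of the next.\<close>

lemma cut_at_idem: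
  assumes "cut_at g c x" "invar c"
  shows "cut_at g x x"
proof -
  have x: "procs x = procs c" "init_msgs x = init_msgs c"
    "msgs x = {m \<in> msgs c. m \<in> init_msgs c \<or> epoch_of m \<le> g}"
    using assms(1) by (auto simp: cut_at_def)
  have ee: "epoch_end (msgs x) s g n" if "epoch_end (msgs c) s g n" for s n
    unfolding epoch_end_def
  proof (intro conjI allI impI)
    show "fst \<delta> \<le> g \<longleftrightarrow> k < n" if "Msg k s \<delta> \<in> msgs x" for k \<delta>
      using that \<open>epoch_end (msgs c) s g n\<close> x(3) unfolding epoch_end_def by blast
    fix k assume "k < n"
    with that obtain \<delta> where "Msg k s \<delta> \<in> msgs c" "fst \<delta> \<le> g"
      unfolding epoch_end_def by blast
    then show "\<exists>\<delta>. Msg k s \<delta> \<in> msgs x"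
      using x(3) by (intro exI[of _ \<delta>]) simp
  qed
  have "if e \<le> g then states x ! p = states x ! p \<and> nums x ! p = nums x ! p
         else states x ! p = (fmfilter (\<lambda>e. e \<le> g) a, Normal (g + 1) (the (fmlookup a g))) \<and>
           dom (nums x ! p) = dom (nums x ! p) \<and>
           (\<forall>s n. (nums x ! p) s = Some n \<longrightarrow> epoch_end (msgs x) s g n)"
    if p: "p < length (procs c)" "states x ! p = (a, Normal e v)" for p a e v
  proof (cases "e \<le> g")
    case False
    obtain b e' v' where c: "states c ! p = (b, Normal e' v')"
      using invarE[OF assms(2) p(1)] by metis
    with False assms(1) p have "\<not> e' \<le> g"
      by (auto simp: cut_at_def)
    with assms(1) p c have
      "states x ! p = (fmfilter (\<lambda>e. e \<le> g) b, Normal (g + 1) (the (fmlookup b g)))"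
      "\<forall>s n. (nums x ! p) s = Some n \<longrightarrow> epoch_end (msgs c) s g n"
      by (auto simp: cut_at_def)
    moreover from this(1) p(2) have "a = fmfilter (\<lambda>e. e \<le> g) b" by simp
    ultimately show ?thesis
      using False ee by (auto intro!: fmap_ext)
  qed simp
  then show ?thesis
    unfolding cut_at_def x(1,2) using x(3) by blast
qed

text \<open>In a snapshot at \<open>g\<close> no processor is beyond epoch \<open>g + 1\<close> and
  no message other than the initial ones is beyond \<open>g\<close>; so for \<open>h > g\<close>
  there is nothing to cut.\<close>

lemma cut_at_self_mono:
  assumes "cut_at g d d" "g \<le> h"
  shows "cut_at h d d"
proof (cases "g = h")
  case False
  with assms have "g < h" by simp
  have "e \<le> h" if "p < length (procs d)" "states d ! p = (a, Normal e v)" for p a e v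
    using assms(1) that \<open>g < h\<close> by (cases "e \<le> g") (force simp: cut_at_def)+
  moreover have "msgs d = {m \<in> msgs d. m \<in> init_msgs d \<or> epoch_of m \<le> g}"
    using assms(1) by (auto simp: cut_at_def)
  then have "msgs d = {m \<in> msgs d. m \<in> init_msgs d \<or> epoch_of m \<le> h}"
    using \<open>g < h\<close> by (auto dest: equalityD1)
  ultimately show ?thesis
    unfolding cut_at_def by (simp cong: conj_cong)
qed (use assms in simp)

text \<open>The run starts at the current snapshot and not at the initial configuration: after a
  recovery the empty run suffices.\<close>

definition snapshot_reachable :: "('s, 'v, 'w) config \<Rightarrow> bool" where
  "snapshot_reachable c \<longleftrightarrow> invar c \<and>
     (\<exists>d g. gce c = Some g \<and> lcs c = Some d \<and> invar d \<and> gce d = Some g \<and> cut_at g d d \<and>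
        run_by UNIV d c)"

lemma snapshot_reachable_self:
  assumes "invar d" "gce d = Some g" "cut_at g d d"
  shows "snapshot_reachable d" "lcs d = Some d"
  using assms lcs_cut_at[OF assms] run_by_refl unfolding snapshot_reachable_def by blast+

text \<open>The case that the greatest common epoch does not change is included: all processors of
  \<open>d\<close> are past \<open>g\<close>, so postponing at \<open>h = g\<close> postpones
  everything.\<close>

lemma snapshot_reachable_step:
  assumes "snapshot_reachable c" "pstep normal_rules p X \<sigma> c c'"
  obtains d d' where "snapshot_reachable c'" "lcs c = Some d" "lcs c' = Some d'" "run_by UNIV d d'"
proof -
  from assms(1) obtain d g where d: "invar c" "gce c = Some g" "lcs c = Some d" "invar d"
    "gce d = Some g" "cut_at g d d" "run_by UNIV d c"
    unfolding snapshot_reachable_def by blast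
  have invar': "invar c'" by (rule invar_pstep[OF d(1) assms(2)])
  obtain h where h: "gce c' = Some h" "g \<le> h"
    using pstep_gce_mono[OF invar_wf_config[OF d(1)] assms(2) d(2)] by blast
  have "run_by UNIV d c'"
    using d(7) assms(2) by (rule run_by_step) simp
  from postpone[OF this d(4) cut_at_self_mono[OF d(6) h(2)]] obtain x where
    x: "run_by UNIV d x" "run_by (past h c') x c'" "cut_at h c' x" by blast
  note lcs = lcs_cut_at[OF invar' h(1) x(3)]
  have "gce x = Some h"
    using gce_lcs[OF lcs] h(1) invar_lengths(1,3)[OF invar'] by force
  then have "snapshot_reachable c'"
    unfolding snapshot_reachable_def
    using invar' h(1) lcs invar_run[OF d(4) x(1)] cut_at_idem[OF x(3) invar'] run_by_mono[OF x(2)]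
    by blast
  with d(3) lcs x(1) show ?thesis by (intro that)
qed

text \<open>The initial messages kept by the snapshot are either already output or beyond the
  greatest common epoch, which has not changed.\<close>

lemma out_lcs:
  assumes "invar c" "lcs c = Some d"
  shows "out d = out c"
proof -
  have "gce d = gce c"
    using gce_lcs[OF assms(2)] invar_lengths(1,3)[OF assms(1)] by force
  moreover have "msgs d = init_msgs c \<union> out c"
    using assms(2) by (auto simp: lcs_def split: option.splits if_splits)
  ultimately show ?thesis
    using invar_init_msgs[OF assms(1)] by (auto simp: out_def)
qed


section \<open>Initial configurations\<close>

text \<open>The counterpart of \<open>expects\<close> for lists; recording the epoch expected after
  the list makes chains composable.\<close>

fun epoch_chain :: "nat \<Rightarrow> (nat \<times> 'w data) list \<Rightarrow> nat \<Rightarrow> bool" where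
  "epoch_chain e [] e' \<longleftrightarrow> e' = e"
| "epoch_chain e (\<delta> # l) e' \<longleftrightarrow> fst \<delta> = e \<and> epoch_chain (next_epoch \<delta>) l e'"

lemma epoch_chain_append:
  "epoch_chain e l e' \<Longrightarrow> epoch_chain e' l' e'' \<Longrightarrow> epoch_chain e (l @ l') e''"
  by (induction l arbitrary: e) auto

lemma epoch_chain_epoch: "epoch_chain e (epoch e ws) (Suc e)"
  by (induction ws) (auto simp: epoch_def)

lemma epochs_upto_Suc: "epochs_upto ws (Suc k) = epochs_upto ws k @ epoch (Suc k) (ws (Suc k))"
  by (simp add: epochs_upto_def)

lemma epoch_chain_epochs_upto: "epoch_chain 1 (epochs_upto ws k) (Suc k)"
proof (induction k)
  case 0
  show ?case by (simp add: epochs_upto_def)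
next
  case (Suc k)
  from epoch_chain_append[OF this epoch_chain_epoch] show ?case
    by (simp add: epochs_upto_Suc)
qed

lemma epoch_chain_nth:
  assumes "epoch_chain e l e'" "n < length l"
  shows "fst (l ! n) = (case n of 0 \<Rightarrow> e | Suc k \<Rightarrow> next_epoch (l ! k))"
  using assms
proof (induction l arbitrary: e n)
  case (Cons \<delta> l)
  show ?case
  proof (cases n)
    case 0
    with Cons.prems show ?thesis by simp
  next
    case (Suc k)
    with Cons.IH[of "next_epoch \<delta>" k] Cons.prems show ?thesis
      by (cases k) auto
  qed
qed simp

lemma epochs_upto_prefix:
  assumes "k \<le> k'"
  shows "\<exists>l. epochs_upto ws k' = epochs_upto ws k @ l"
  using assms by (induction k' rule: dec_induct) (auto simp: epochs_upto_Suc)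

text \<open>The input is a union over \<open>k\<close> of the first \<open>k\<close> epochs, as
  there may be infinitely many. These lists are prefixes of each other, so a position has the same
  body for every \<open>k\<close> that reaches it.\<close>

lemma wf_stream_inputs:
  assumes "on_stream M s =
    {Msg n s (epochs_upto ws k ! n) | n k. enat k \<le> E \<and> n < length (epochs_upto ws k)}"
  shows "wf_stream M s"
proof -
  have M: "Msg n s \<delta> \<in> M \<longleftrightarrow>
      (\<exists>k. enat k \<le> E \<and> n < length (epochs_upto ws k) \<and> \<delta> = epochs_upto ws k ! n)" for n \<delta>
  proof -
    have "Msg n s \<delta> \<in> M \<longleftrightarrow> Msg n s \<delta> \<in> on_stream M s"
      by (simp add: on_stream_def)
    then show ?thesis
      unfolding assms by auto
  qed
  have agree: "epochs_upto ws k ! n = epochs_upto ws k' ! n"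
    if "n < length (epochs_upto ws k)" "n < length (epochs_upto ws k')" for n k k'
    using that
  proof (induction k k' rule: linorder_wlog)
    case (le k k')
    with epochs_upto_prefix[of k k' ws] show ?case by (auto simp: nth_append)
  qed simp
  have "expects M s n (fst \<delta>)" if "Msg n s \<delta> \<in> M" for n \<delta>
  proof -
    from that M obtain k where k: "enat k \<le> E" "n < length (epochs_upto ws k)"
      "\<delta> = epochs_upto ws k ! n"
      by blast
    show ?thesis
    proof (cases n)
      case 0
      with k epoch_chain_nth[OF epoch_chain_epochs_upto k(2)] show ?thesis
        by (simp add: expects_def)
    next
      case (Suc j)
      then have "Msg j s (epochs_upto ws k ! j) \<in> M"
        using k M by auto
      with Suc k epoch_chain_nth[OF epoch_chain_epochs_upto k(2)] show ?thesis
        by (auto simp: expects_def)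
    qed
  qed
  moreover have "\<delta> = \<delta>'" if "Msg n s \<delta> \<in> M" "Msg n s \<delta>' \<in> M" for n \<delta> \<delta>'
  proof -
    from that obtain k k' where "n < length (epochs_upto ws k)" "\<delta> = epochs_upto ws k ! n"
      "n < length (epochs_upto ws k')" "\<delta>' = epochs_upto ws k' ! n"
      unfolding M by blast
    with agree[OF this(1,3)] show ?thesis by simp
  qed
  ultimately show ?thesis
    unfolding wf_stream_def by blast
qed

text \<open>The archives hold epoch 0 only, so the initial configuration is its own
  snapshot.\<close>

lemma valid_init_snapshot:
  assumes "c \<in> valid_init"
  shows "snapshot_reachable c" "lcs c = Some c"
proof -
  have c: "wf_config c" "valid_graph (procs c)"
    "\<And>\<sigma>. \<sigma> \<in> set (states c) \<Longrightarrow> \<exists>v. \<sigma> = (fmupd 0 v fmempty, Normal 1 v)"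
    "\<And>N s. N \<in> set (nums c) \<Longrightarrow> s \<in> dom N \<Longrightarrow> N s = Some 0"
    "init_msgs c = msgs c" "wf_inputs (procs c) (msgs c)"
    using assms unfolding valid_init_def by auto
  have len: "length (states c) = length (procs c)" "length (nums c) = length (procs c)"
    "procs c \<noteq> []"
    using c(1) by (auto simp: wf_config_def)
  have src: "strm m \<in> sources (procs c)" if "m \<in> msgs c" for m
    using c(6) that by (auto simp: wf_inputs_def)
  have wf: "wf_stream (msgs c) s" for s
  proof (cases "s \<in> sources (procs c)")
    case True
    from c(6) obtain E :: enat where "\<forall>s \<in> sources (procs c). \<exists>ws. on_stream (msgs c) s =
        {Msg n s (epochs_upto ws k ! n) | n k. enat k \<le> E \<and> n < length (epochs_upto ws k)}"
      unfolding wf_inputs_def by (elim conjE exE)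
    from bspec[OF this True] show ?thesis
      by (elim exE) (rule wf_stream_inputs)
  next
    case False
    with src have "Msg n s \<delta> \<notin> msgs c" for n \<delta>
      by fastforce
    then show ?thesis by (auto simp: wf_stream_def)
  qed
  have state: "\<exists>v. states c ! p = (fmupd 0 v fmempty, Normal 1 v)" if "p < length (procs c)" for p
    using c(3) that len by simp
  have num: "n = 0" if "p < length (procs c)" "(nums c ! p) s = Some n" for p s n
    using c(4)[of "nums c ! p" s] that len by auto
  have tail: "Msg k (outs (procs c ! p)) \<delta> \<notin> msgs c" if "p < length (procs c)" for p k \<delta>
    using src[of "Msg k (outs (procs c ! p)) \<delta>"] that by (auto simp: sources_def)
  have "distinct (ins \<pi>) \<and> outs \<pi> \<notin> set (ins \<pi>)" if \<pi>: "\<pi> \<in> set (procs c)" for \<pi>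
  proof
    show "distinct (ins \<pi>)"
      using c(2) \<pi> by (auto simp: valid_graph_def)
    obtain p where "p < length (procs c)" "\<pi> = procs c ! p"
      using \<pi> by (metis in_set_conv_nth)
    moreover have "(p, p) \<notin> task_graph (procs c)"
      using c(2) by (auto simp: valid_graph_def acyclic_def)
    ultimately show "outs \<pi> \<notin> set (ins \<pi>)"
      by (auto simp: task_graph_def)
  qed
  moreover have "\<exists>a e v. states c ! p = (a, Normal e v) \<and> fmdom' a = {..<e} \<and> 0 < e \<and>
      proc_streams (outs (procs c ! p)) (nums c ! p) (msgs c) (\<lambda>_. e)"
    if p: "p < length (procs c)" for p
  proof -
    obtain v where "states c ! p = (fmupd 0 v fmempty, Normal 1 v)"
      using state[OF p] by blast
    moreover have "fmdom' (fmupd (0 :: nat) v fmempty) = {..<1}"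
      by auto
    moreover have "proc_streams (outs (procs c ! p)) (nums c ! p) (msgs c) (\<lambda>_. 1)"
      unfolding proc_streams_def
    proof (intro conjI allI impI)
      show "expects (msgs c) s n 1" if "(nums c ! p) s = Some n" for s n
        using num[OF p that] by (simp add: expects_def)
    qed (use wf tail[OF p] in auto)
    ultimately show ?thesis by auto
  qed
  ultimately have invar: "invar c"
    using c(1,2,5) unfolding invar_def valid_graph_def by blast
  have gce: "gce c = Some 0"
    using len state by (intro gce_const) (auto, force+)
  \<comment> \<open>Epochs on streams start at 1, so epoch 0 ends at position 0, where all counters
    are.\<close>
  have ee: "epoch_end (msgs c) s 0 0" for s
    using expects_after[OF wf, of s 0 1] by (force simp: epoch_end_def expects_def)
  have "if e \<le> 0 then states c ! p = states c ! p \<and> nums c ! p = nums c ! p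
         else states c ! p = (fmfilter (\<lambda>e. e \<le> 0) a, Normal (0 + 1) (the (fmlookup a 0))) \<and>
           dom (nums c ! p) = dom (nums c ! p) \<and>
           (\<forall>s n. (nums c ! p) s = Some n \<longrightarrow> epoch_end (msgs c) s 0 n)"
    if p: "p < length (procs c)" "states c ! p = (a, Normal e v)" for p a e v
    using state[OF p(1)] p(2) num[OF p(1)] ee by auto
  moreover have "msgs c = {m \<in> msgs c. m \<in> init_msgs c \<or> epoch_of m \<le> 0}"
    using c(5) by auto
  ultimately have cut: "cut_at 0 c c"
    unfolding cut_at_def by blast
  from snapshot_reachable_self[OF invar gce cut] show "snapshot_reachable c" "lcs c = Some c" .
qed


section \<open>Failures\<close>

text \<open>\<open>h\<close> is \<open>c\<close> with every failed processor given back its last normal volatile state.\<close>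

definition healed :: "('s, 'v, 'w) config \<Rightarrow> ('s, 'v, 'w) config \<Rightarrow> bool" where
  "healed c h \<longleftrightarrow> procs h = procs c \<and> nums h = nums c \<and> msgs h = msgs c \<and>
     init_msgs h = init_msgs c \<and> length (states h) = length (states c) \<and>
     (\<forall>p < length (states c). fst (states h ! p) = fst (states c ! p) \<and>
        (states h ! p = states c ! p \<or> snd (states c ! p) = Failed))"

lemma healed_refl: "healed c c"
  by (simp add: healed_def)

lemma healed_archives: "healed c h \<Longrightarrow> map fst (states h) = map fst (states c)"
  by (auto simp: healed_def intro!: nth_equalityI)

lemma healed_out:
  assumes "healed c h"
  shows "out h = out c"
  using gce_cong[OF healed_archives[OF assms]] assms by (simp add: out_def healed_def)

text \<open>States enter \<open>lcs\<close> only through their archives, which failures preserve;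
  the restatement via \<open>map fst\<close> makes this visible.\<close>

lemma healed_lcs:
  assumes "healed c h"
  shows "lcs h = lcs c"
proof -
  have *: "lcs c = (case gce c of None \<Rightarrow> None
     | Some g \<Rightarrow>
        if (\<forall>a \<in> set (map fst (states c)). g \<in> fmdom' a) \<and>
           (\<forall>N \<in> set (nums c). \<forall>s \<in> dom N. finite (on_stream (out c) s))
        then Some (Config (procs c)
          (map (\<lambda>a. (fmfilter (\<lambda>e. e \<le> g) a, Normal (g + 1) (the (fmlookup a g))))
            (map fst (states c)))
          (map (\<lambda>N s. if s \<in> dom N then Some (card (on_stream (out c) s)) else None) (nums c))
          (init_msgs c \<union> out c)
          (init_msgs c))
        else None)" for c :: "('s, 'v, 'w) config"
    unfolding lcs_def list.map_comp by (simp add: case_prod_unfold o_def cong: option.case_cong if_cong)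
  have "procs h = procs c" "nums h = nums c" "init_msgs h = init_msgs c"
    using assms by (auto simp: healed_def)
  then show ?thesis
    unfolding * gce_cong[OF healed_archives[OF assms]] healed_archives[OF assms]
      healed_out[OF assms] by presburger
qed

text \<open>A failed processor makes no normal step, so every normal step can be copied in
  \<open>h\<close>. A failure leaves \<open>h\<close> as it is, and a recovery leads to the snapshot
  of \<open>h\<close>, which has no failed processor and is its own snapshot.\<close>

lemma healed_step:
  assumes "healed c h" "snapshot_reachable h" "step impl_rules c c'"
  obtains h' d d' where "healed c' h'" "snapshot_reachable h'" "lcs c = Some d" "lcs c' = Some d'"
    "run_by UNIV d d'"
  using assms(3)
proof (cases rule: step_cases)
  case (proc p X \<sigma>')
  then obtain N' M' where p: "p < length (procs c)"
    "local_step impl_rules (procs c ! p) (states c ! p) X \<sigma>'"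
    "apply_actions X (nums c ! p, msgs c) = Some (N', M')"
    "c' = Config (procs c) ((states c)[p := \<sigma>']) ((nums c)[p := N']) M' (init_msgs c)"
    by (auto simp: pstep_def)
  have len: "p < length (states c)"
    using assms(1,2) p(1) by (auto simp: healed_def snapshot_reachable_def invar_lengths)
  from p(2) show ?thesis
  proof (cases rule: local_step_impl_cases)
    case normal
    then have "snd (states c ! p) \<noteq> Failed"
      by (cases rule: local_step_normal_cases) auto
    with len have same: "states h ! p = states c ! p"
      using assms(1) by (auto simp: healed_def)
    define h' where
      "h' = Config (procs h) ((states h)[p := \<sigma>']) ((nums h)[p := N']) M' (init_msgs h)"
    have "pstep normal_rules p X \<sigma>' h h'"
      using assms(1) p normal same by (auto simp: pstep_def healed_def h'_def)
    moreover have healed': "healed c' h'"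
      using assms(1) p(4) len by (auto simp: healed_def h'_def nth_list_update)
    ultimately obtain d d' where "snapshot_reachable h'" "lcs h = Some d" "lcs h' = Some d'"
      "run_by UNIV d d'"
      using snapshot_reachable_step[OF assms(2)] by blast
    with healed' show ?thesis
      unfolding healed_lcs[OF assms(1)] healed_lcs[OF healed'] by (intro that)
  next
    case fail
    with p have "c' = Config (procs c) ((states c)[p := (fst (states c ! p), Failed)]) (nums c)
        (msgs c) (init_msgs c)"
      by auto
    with assms(1) len have healed': "healed c' h"
      by (auto simp: healed_def nth_list_update)
    obtain d where d: "lcs h = Some d"
      using assms(2) by (auto simp: snapshot_reachable_def)
    with healed' assms(2) run_by_refl show ?thesis
      by (intro that[of h d d]) (auto simp: healed_lcs[OF assms(1)] healed_lcs[OF healed', symmetric])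
  qed
next
  case (recover a)
  then have "lcs h = Some c'"
    using healed_lcs[OF assms(1)] by simp
  then obtain g where "invar c'" "gce c' = Some g" "cut_at g c' c'"
    using assms(2) by (auto simp: snapshot_reachable_def)
  from snapshot_reachable_self[OF this] recover(2) healed_refl run_by_refl show ?thesis
    by (intro that[of c' c' c'])
qed


section \<open>Concatenating runs\<close>

lemma rtranclp_path:
  assumes "R\<^sup>*\<^sup>* x y"
  shows "\<exists>ys. successively R (x # ys) \<and> last (x # ys) = y"
  using assms
proof (induction rule: rtranclp_induct)
  case base
  show ?case by (intro exI[of _ "[]"]) simp
next
  case (step y z)
  then obtain ys where "successively R (x # ys)" "last (x # ys) = y" by blast
  with step.hyps(2) show ?case
    by (intro exI[of _ "ys @ [z]"]) (auto simp: successively_append_iff simp flip: append_Cons)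
qed

text \<open>The runs may be empty, even all from some point on, so the result is finite or infinite
  according to whether the lengths of the partial concatenations are bounded.\<close>

lemma concat_runs:
  fixes L :: "nat \<Rightarrow> 'a"
  assumes "\<And>i. R\<^sup>*\<^sup>* (L i) (L (Suc i))"
  obtains C where "0 < slen C" "snth C 0 = L 0"
    "\<And>i. 0 < i \<Longrightarrow> enat i < slen C \<Longrightarrow> R (snth C (i - 1)) (snth C i)"
    "\<And>i. \<exists>m. enat m < slen C \<and> snth C m = L i"
proof -
  have "\<forall>i. \<exists>ys. successively R (L i # ys) \<and> last (L i # ys) = L (Suc i)"
    using rtranclp_path[OF assms] by blast
  then obtain P where P: "\<And>i. successively R (L i # P i)" "\<And>i. last (L i # P i) = L (Suc i)"
    by metis
  \<comment> \<open>\<open>P i\<close> omits its starting point \<open>L i\<close>, which is already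
    the last entry of the list before it.\<close>
  define xs where "xs = rec_nat [L 0] (\<lambda>i l. l @ P i)"
  have xs: "xs 0 = [L 0]" "\<And>i. xs (Suc i) = xs i @ P i"
    by (simp_all add: xs_def)
  have ne: "xs i \<noteq> []" for i
    by (induction i) (auto simp: xs)
  have last: "last (xs i) = L i" for i
  proof (induction i)
    case (Suc i)
    with P(2)[of i] show ?case by (cases "P i") (auto simp: xs)
  qed (simp add: xs)
  have chain: "successively R (xs i)" for i
  proof (induction i)
    case (Suc i)
    with P(1)[of i] last[of i] ne[of i] show ?case
      by (cases "P i") (auto simp: xs successively_append_iff)
  qed (simp add: xs)
  have step: "R (xs i ! (n - 1)) (xs i ! n)" if "0 < n" "n < length (xs i)" for i n
    using chain[of i] that successively_conv_nth[of R "xs i"] by (cases n) auto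
  have prefix: "\<exists>l. xs j = xs i @ l" if "i \<le> j" for i j
    using that by (induction j rule: dec_induct) (auto simp: xs)
  have agree: "xs i ! n = xs j ! n" if "n < length (xs i)" "n < length (xs j)" for i j n
    using that
  proof (induction i j rule: linorder_wlog)
    case (le i j)
    with prefix[of i j] show ?case by (auto simp: nth_append)
  qed simp
  have visit: "xs i ! (length (xs i) - 1) = L i" for i
    using last[of i] last_conv_nth[OF ne[of i]] by simp
  have start: "xs i ! 0 = L 0" for i
    using agree[of 0 i 0] ne[of i] xs(1) by simp
  show ?thesis
  proof (cases "\<forall>n. \<exists>i. n < length (xs i)")
    case True
    then obtain f where f: "\<And>n. n < length (xs (f n))" by metis
    define g where "g n = xs (f n) ! n" for n
    have g: "g n = xs i ! n" if "n < length (xs i)" for n i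
      unfolding g_def using f that by (rule agree)
    show ?thesis
    proof (rule that[of "Inf g"])
      show "R (snth (Inf g) (n - 1)) (snth (Inf g) n)" if "0 < n" for n
        using step[OF that f[of n]] g[of n "f n"] g[of "n - 1" "f n"] f[of n] by simp
      show "\<exists>m. enat m < slen (Inf g) \<and> snth (Inf g) m = L i" for i
        using g[of "length (xs i) - 1" i] visit[of i] ne[of i]
        by (intro exI[of _ "length (xs i) - 1"]) simp
    qed (use g[of 0 0] xs(1) in auto)
  next
    case False
    then obtain n where n: "\<And>i. length (xs i) \<le> n"
      by (auto simp: not_less)
    \<comment> \<open>All \<open>xs j\<close> are prefixes of a longest one, which therefore visits
      every \<open>L j\<close>.\<close>
    obtain i where i: "\<And>j. length (xs j) \<le> length (xs i)"
      using ex_has_greatest_nat[of "\<lambda>_. True" 0 "\<lambda>i. length (xs i)" "Suc n"] n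
      by (auto simp: less_Suc_eq_le)
    show ?thesis
    proof (rule that[of "Fin (xs i)"])
      show "\<exists>m. enat m < slen (Fin (xs i)) \<and> snth (Fin (xs i)) m = L j" for j
      proof -
        have "length (xs j) - 1 < length (xs i)"
          using i[of j] ne[of j] ne[of i] by (cases "xs j") auto
        with agree[of "length (xs j) - 1" j i] visit[of j] ne[of j] show ?thesis
          by (intro exI[of _ "length (xs j) - 1"]) auto
      qed
    qed (use step start ne in \<open>auto simp: zero_enat_def\<close>)
  qed
qed


section \<open>Failure transparency\<close>

theorem theorem6p9:
  shows "failure_transparent impl_rules failure_rules
    (out :: ('s, 'v, 'w) config \<Rightarrow> ('s, 'w) msg set) valid_init"
  unfolding failure_transparent_def normal_rules_eq
proof (intro conjI ballI)
  show "failure_rules \<subseteq> impl_rules"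
    by (auto simp: impl_rules_def)
  show "observability_function impl_rules (out :: ('s, 'v, 'w) config \<Rightarrow> ('s, 'w) msg set)"
    by (rule observability_out)
  fix c :: "('s, 'v, 'w) config" and C
  assume c: "c \<in> valid_init" and "C \<in> executions impl_rules c"
  then have C: "0 < slen C" "snth C 0 = c"
    "\<And>i. enat (Suc i) < slen C \<Longrightarrow> step impl_rules (snth C i) (snth C (Suc i))"
    by (auto simp: executions_def)
  have healed: "\<exists>h. healed (snth C i) h \<and> snapshot_reachable h" if "enat i < slen C" for i
    using that
  proof (induction i)
    case 0
    with C(2) valid_init_snapshot(1)[OF c] healed_refl show ?case by blast
  next
    case (Suc i)
    then have "enat i < slen C"
      by (metis Suc_ile_eq order.strict_implies_order order.strict_trans1 enat_ord_simps(2) lessI)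
    with Suc C(3) show ?case
      by (meson healed_step)
  qed
  \<comment> \<open>\<open>concat_runs\<close> wants an infinite sequence. If \<open>C\<close> is
    finite, the index stays at its last position, the length minus one; from there on all runs are
    empty.\<close>
  define L where "L i = the (lcs (snth C (if enat i < slen C then i else the_enat (slen C) - 1)))" for i
  have L: "L i = the (lcs (snth C i))" if "enat i < slen C" for i
    using that by (simp add: L_def)
  have "(step normal_rules)\<^sup>*\<^sup>* (L i) (L (Suc i))" for i
  proof (cases "enat (Suc i) < slen C")
    case True
    then have i: "enat i < slen C"
      by (metis order.strict_trans enat_ord_simps(2) lessI)
    from healed[OF i] obtain h where "healed (snth C i) h" "snapshot_reachable h" by blast
    then obtain d d' where "lcs (snth C i) = Some d" "lcs (snth C (Suc i)) = Some d'"
      "run_by UNIV d d'"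
      using healed_step[OF _ _ C(3)[OF True]] by blast
    with L[OF i] L[OF True] show ?thesis
      using run_by_imp_steps by simp
  next
    case False
    then obtain n where n: "slen C = enat n" "n \<le> Suc i"
      by (cases "slen C") auto
    then have "L i = L (Suc i)"
      using C(1) by (cases "n = Suc i") (auto simp: L_def)
    then show ?thesis by simp
  qed
  then obtain C' where C': "0 < slen C'" "snth C' 0 = L 0"
    "\<And>i. 0 < i \<Longrightarrow> enat i < slen C' \<Longrightarrow> step normal_rules (snth C' (i - 1)) (snth C' i)"
    "\<And>i. \<exists>m. enat m < slen C' \<and> snth C' m = L i"
    by (rule concat_runs[of "step normal_rules" L]) blast+
  have "L 0 = c"
    using L[of 0] C(1,2) valid_init_snapshot(2)[OF c] by (simp add: zero_enat_def)
  with C' have "C' \<in> executions normal_rules c"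
    by (simp add: executions_def)
  moreover have "\<exists>m'. enat m' < slen C' \<and> out (snth C m) = out (snth C' m')"
    if m: "enat m < slen C" for m
  proof -
    from healed[OF m] obtain h where h: "healed (snth C m) h" "snapshot_reachable h" by blast
    then obtain d where "invar h" "lcs h = Some d"
      by (auto simp: snapshot_reachable_def)
    with h(1) have "out d = out (snth C m)" "L m = d"
      using out_lcs healed_out healed_lcs L[OF m] by fastforce+
    with C'(4)[of m] show ?thesis by metis
  qed
  ultimately show "\<exists>C'\<in>executions normal_rules c. \<forall>m. enat m < slen C \<longrightarrow>
      (\<exists>m'. enat m' < slen C' \<and> out (snth C m) = out (snth C' m'))"
    by blast
qed

end
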